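(* For all integers $g\ge1$ and $n\ge1$, $H^\sim_{g,n}=H_{g,n}$.
   Context: Complex origami counts. - For $\lambda\vdash n$ let $C_\lambda\subset S_n$ be the conjugacy class of cycle type $\lambda$. - Let $h^\circ_{\lambda,n}=\frac{1}{n!}\#\{(\sigma,\rho)\in S_n\times S_n:\sigma\rho\sigma^{-1}\rho^{-1}\in C_\lambda\}$. - Define $h_{\lambda,n}$ as the coefficients of the logarithm $$\log\Bigl(\sum_{n\ge0}\sum_{\lambda\vdash n}h^\circ_{\lambda,n}p_\lambda t^n\Bigr)=\sum_{n\ge1}\sum_{\lambda\vdash n}h_{\lambda,n}p_\lambda t^n,$$ where $p_\lambda=\prod_i p_{\lambda_i}$ are products of formal power-sum variables. - Put $H_{g,n}=\sum_{\lambda\vdash n,\ \ell(\lambda)=n+2-2g}h_{\lambda,n}$, where $\ell(\lambda)$ is the number of parts of $\lambda$. This is the weighted number of connected origami of degree $n$ and genus $g$. Monotone double Hurwitz numbers. - A sequence of transpositions $\tau_i=(a_i,b_i)$ with $a_i<b_i$ is strictly monotone if $b_i<b_{i+1}$ for all $i$. - Define $$H^\sim_{g,n}=\frac{1}{n!}\#\{(\sigma,\rho,\tau_1,\dots,\tau_{2g-2})\},$$ counting tuples such that: $\sigma,\rho\in S_n$; each $\tau_i\in S_n$ is a transposition; $(\tau_1,\dots,\tau_{2g-2})$ is strictly monotone; $\sigma\rho\sigma^{-1}\rho^{-1}\tau_1\cdots\tau_{2g-2}=\mathrm{id}$; and the group $\langle\tau_1,\dots,\tau_{2g-2},\sigma,\rho\rangle$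 acts transitively on $\{1,\dots,n\}$. *)

theory Defs
  imports Complex_Main "HOL-Combinatorics.Combinatorics" "HOL-Library.Multiset"
begin

definition cycle_type :: "nat \<Rightarrow> (nat \<Rightarrow> nat) \<Rightarrow> nat multiset" where
  "cycle_type n \<sigma> = image_mset card (mset_set ((\<lambda>x. orbit \<sigma> x) ` {1..n}))"

definition commutator :: "(nat \<Rightarrow> nat) \<Rightarrow> (nat \<Rightarrow> nat) \<Rightarrow> (nat \<Rightarrow> nat)" where
  "commutator \<sigma> \<rho> = \<sigma> \<circ> \<rho> \<circ> inv \<sigma> \<circ> inv \<rho>"

definition hcirc :: "nat multiset \<Rightarrow> real" where
  "hcirc lam = (let n = sum_mset lam in
     real (card {(\<sigma>, \<rho>). \<sigma> permutes {1..n} \<and> \<rho> permutes {1..n}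
                  \<and> cycle_type n (commutator \<sigma> \<rho>) = lam}) / fact n)"

text \<open>The generating series sum h-circ_{lambda,n} p_lambda t^n is the formal series
  F whose coefficient of the monomial p_lambda t^{|lambda|} is hcirc lambda
  (t-degree equals |lambda|); its constant term is hcirc {#} = 1.
  log F = sum_{k>=1} (-1)^(k+1)/k (F-1)^k; the coefficient of p_lambda in (F-1)^k
  is the sum over ordered k-tuples of nonempty monomials multiplying to p_lambda.\<close>
definition ordered_factorisations :: "nat multiset \<Rightarrow> nat multiset list set" where
  "ordered_factorisations lam = {ms. (\<forall>\<mu>\<in>set ms. \<mu> \<noteq> {#}) \<and> sum_list ms = lam}"

definition hcoef :: "nat multiset \<Rightarrow> real" where
  "hcoef lam = (\<Sum>ms\<in>ordered_factorisations lam.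
      (-1) ^ (length ms + 1) / real (length ms) * (\<Prod>\<mu>\<leftarrow>ms. hcirc \<mu>))"

definition partitions_of :: "nat \<Rightarrow> nat multiset set" where
  "partitions_of n = {lam. (\<forall>x\<in>#lam. 0 < x) \<and> sum_mset lam = n}"

definition H :: "nat \<Rightarrow> nat \<Rightarrow> real" where
  "H g n = (\<Sum>lam\<in>{lam\<in>partitions_of n. int (size lam) = int n + 2 - 2 * int g}. hcoef lam)"

inductive_set gen_group :: "(nat \<Rightarrow> nat) set \<Rightarrow> (nat \<Rightarrow> nat) set" for S where
  gen_id: "id \<in> gen_group S"
| gen_base: "f \<in> S \<Longrightarrow> f \<in> gen_group S"
| gen_comp: "f \<in> gen_group S \<Longrightarrow> g \<in> gen_group S \<Longrightarrow> f \<circ> g \<in> gen_group S"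
| gen_inv: "f \<in> gen_group S \<Longrightarrow> inv f \<in> gen_group S"

text \<open>A transposition tau_i = (a_i,b_i), a_i < b_i, is recorded by the pair (a_i,b_i).\<close>
definition strictly_monotone :: "(nat \<times> nat) list \<Rightarrow> bool" where
  "strictly_monotone ts = (\<forall>i. Suc i < length ts \<longrightarrow> snd (ts ! i) < snd (ts ! Suc i))"

definition Htilde :: "nat \<Rightarrow> nat \<Rightarrow> real" where
  "Htilde g n = real (card {(\<sigma>, \<rho>, ts).
       \<sigma> permutes {1..n} \<and> \<rho> permutes {1..n}
     \<and> length ts = 2 * g - 2
     \<and> (\<forall>(a, b)\<in>set ts. 1 \<le> a \<and> a < b \<and> b \<le> n)
     \<and> strictly_monotone ts
     \<and> commutator \<sigma> \<rho> \<circ> foldr (\<lambda>(a, b) f. transpose a b \<circ> f) ts id = id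
     \<and> (\<forall>x\<in>{1..n}. \<forall>y\<in>{1..n}. \<exists>f\<in>gen_group ({\<sigma>, \<rho>} \<union> (\<lambda>(a, b). transpose a b) ` set ts). f x = y)})
     / fact n"

end

theory Submission
  imports Defs "HOL-Library.Infinite_Set"
begin

text \<open>Both sides count pairs \<open>(\<sigma>, \<rho>)\<close> that generate a transitive group and whose commutator has
  \<open>n + 2 - 2 g\<close> cycles.

  For \<open>H\<close> this is the exponential formula. Splitting a pair at the component of the point 1 gives
  \<open>|\<lambda>| f(\<lambda>) = \<Sum> |\<mu>| c(\<mu>) f(\<lambda> - \<mu>)\<close>, summed over \<open>\<mu> \<subseteq> \<lambda>\<close>, between the normalised counts \<open>f\<close> of all
  pairs and \<open>c\<close> of transitive pairs. The coefficients of the logarithm of the series of \<open>f\<close> satisfy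
  the same recursion, which determines them.

  For \<open>Htilde\<close>, every permutation has exactly one strictly monotone factorisation into transpositions
  (Jucys); its length is \<open>n\<close> minus the number of cycles, and it preserves every set preserved by the
  permutation, so adjoining its factors to \<open>\<sigma>\<close> and \<open>\<rho>\<close> does not affect transitivity.\<close>

section \<open>Coefficients of the logarithm\<close>

text \<open>The weight |\<lambda>| comes from the Euler derivation in t: D F = (D log F) F for every
  D that multiplies the coefficient of p_\<lambda> by an additive w(\<lambda>). As
  \<open>hcoef\<close> is an explicit alternating sum over ordered factorisations with coefficients
  1/k, this identity is proved on lists. A recursion whose leading term has coefficient 1 then
  replaces any use of the exponential series. It is silent where w vanishes, so only positive sizes
  are compared. For the counts the same weight comes from marking a point: its component, of size k
  among n points, can be chosen in C(n-1, k-1) ways, and C(n-1, k-1) / (n-1)! = k / (k! (n-k)!).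
  Components are arbitrary subsets of {1..n}. Pairs are therefore counted over any finite ground
  set, and relabelling brings the counts back to {1..k}. Transitivity is treated as the absence of a
  proper nonempty invariant subset. This form passes to components, and it compares two generating
  sets through the sets they preserve.\<close>

lemma finite_submultisets: "finite {\<mu>. \<mu> \<subseteq># lam}"
proof (rule finite_subset)
  show "{\<mu>. \<mu> \<subseteq># lam} \<subseteq> (\<Union>k\<le>size lam. multisets_of_size (set_mset lam) k)"
    by (auto simp: multisets_of_size_def size_mset_mono dest: mset_subset_eqD)
qed (simp add: finite_multisets_of_size)

lemma finite_strict_submultisets: "finite {\<mu>. \<mu> \<subset># lam}"
  by (rule finite_subset[OF _ finite_submultisets[of lam]]) (auto simp: subset_mset.less_imp_le)

lemma finite_ordered_factorisations: "finite (ordered_factorisations lam)"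
proof (rule finite_subset)
  show "ordered_factorisations lam \<subseteq> {ms. set ms \<subseteq> {\<mu>. \<mu> \<subseteq># lam} \<and> length ms \<le> size lam}"
  proof
    fix ms assume "ms \<in> ordered_factorisations lam"
    then have ne: "\<forall>\<mu>\<in>set ms. \<mu> \<noteq> {#}" and s: "sum_list ms = lam"
      by (auto simp: ordered_factorisations_def)
    have "set ms \<subseteq> {\<mu>. \<mu> \<subseteq># sum_list ms}"
      by (induction ms) (auto intro: subset_mset.order_trans)
    moreover have "length ms \<le> size (sum_list ms)" using ne
    proof (induction ms)
      case (Cons \<mu> ms)
      then have "0 < size \<mu>" by (simp add: nonempty_has_size)
      then show ?case using Cons by fastforce
    qed simp
    ultimately show "ms \<in> {ms. set ms \<subseteq> {\<mu>. \<mu> \<subseteq># lam} \<and> length ms \<le> size lam}"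
      using s by auto
  qed
  show "finite {ms. set ms \<subseteq> {\<mu>. \<mu> \<subseteq># lam} \<and> length ms \<le> size lam}"
    by (intro finite_lists_length_le finite_submultisets)
qed

section \<open>Cyclic rotation of ordered factorisations\<close>

lemma mset_rotate: "mset (rotate i xs) = mset xs"
  by (metis append_take_drop_id mset_append rotate_drop_take union_commute)

lemma prod_list_rotate: "prod_list (rotate i xs) = prod_list (xs :: 'a::comm_monoid_mult list)"
  by (simp add: mset_rotate flip: prod_mset_prod_list)

lemma sum_list_rotate: "sum_list (rotate i xs) = sum_list (xs :: 'a::comm_monoid_add list)"
  by (simp add: mset_rotate flip: sum_mset_sum_list)

lemma rotate_ordered_factorisations:
  "ms \<in> ordered_factorisations lam \<Longrightarrow> rotate i ms \<in> ordered_factorisations lam"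
  by (simp add: ordered_factorisations_def sum_list_rotate)

text \<open>The formula of \<open>hcoef\<close> for an arbitrary coefficient function; if
  \<open>f {#} = 1\<close>, these are the coefficients of the logarithm of the series of
  \<open>f\<close>.\<close>

definition log_coeff :: "(nat multiset \<Rightarrow> real) \<Rightarrow> nat multiset \<Rightarrow> real" where
  "log_coeff f lam = (\<Sum>ms\<in>ordered_factorisations lam.
      (-1) ^ (length ms + 1) / real (length ms) * (\<Prod>\<mu>\<leftarrow>ms. f \<mu>))"

lemma hcoef_eq_log_coeff: "hcoef = log_coeff hcirc"
  by (simp add: fun_eq_iff hcoef_def log_coeff_def)

text \<open>Rotation by \<open>i\<close> permutes the factorisations of length \<open>k\<close>,
  leaves the product of the \<open>f\<close>-values unchanged and brings the factor at position
  \<open>i\<close> to the front.\<close>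

lemma sum_factorisations_rotate:
  fixes w f :: "nat multiset \<Rightarrow> real"
  assumes "i < k"
  shows "(\<Sum>ms | ms \<in> ordered_factorisations lam \<and> length ms = k. w (ms ! i) * (\<Prod>\<mu>\<leftarrow>ms. f \<mu>)) =
    (\<Sum>ms | ms \<in> ordered_factorisations lam \<and> length ms = k. w (hd ms) * (\<Prod>\<mu>\<leftarrow>ms. f \<mu>))"
proof (rule sum.reindex_bij_witness[where j="rotate i" and i="rotate (k - i)"], goal_cases)
  case (1 ms)
  then show ?case using assms by (simp add: rotate_rotate)
next
  case (3 ms)
  then show ?case using assms by (simp add: rotate_rotate)
next
  case (5 ms)
  then have "ms \<noteq> []" using assms by auto
  then have "hd (rotate i ms) = ms ! i"
    using 5 assms by (simp add: hd_rotate_conv_nth)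
  then show ?case by (simp add: rotate_map[symmetric] prod_list_rotate)
qed (auto simp: rotate_ordered_factorisations)

text \<open>Averaging over cyclic rotations of a factorisation turns the total weight divided by the
  length into the weight of the first factor.\<close>
lemma weight_times_log_coeff:
  fixes w f :: "nat multiset \<Rightarrow> real"
  assumes w0: "w {#} = 0" and add: "\<And>\<mu> \<nu>. w (\<mu> + \<nu>) = w \<mu> + w \<nu>"
  shows "w lam * log_coeff f lam =
    (\<Sum>ms\<in>ordered_factorisations lam - {[]}. (-1) ^ (length ms + 1) * w (hd ms) * (\<Prod>\<mu>\<leftarrow>ms. f \<mu>))"
    (is "_ = sum ?s _")
proof -
  let ?O = "ordered_factorisations lam"
  let ?t = "\<lambda>ms. w lam * ((-1) ^ (length ms + 1) / real (length ms) * (\<Prod>\<mu>\<leftarrow>ms. f \<mu>))"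
  define S where "S = ?O - {[]}"
  have fin: "finite S" by (simp add: S_def finite_ordered_factorisations)
  have wsum: "w (sum_list ms) = (\<Sum>i<length ms. w (ms ! i))" for ms
  proof (induction ms)
    case (Cons \<mu> ms)
    then show ?case by (simp add: add sum.lessThan_Suc_shift del: sum.lessThan_Suc)
  qed (simp add: w0)
  have level: "(\<Sum>ms | ms \<in> S \<and> length ms = k. ?t ms) = (\<Sum>ms | ms \<in> S \<and> length ms = k. ?s ms)" for k
  proof (cases "k = 0")
    case True
    then have "{ms. ms \<in> S \<and> length ms = k} = {}" by (auto simp: S_def)
    then show ?thesis by (simp only: sum.empty)
  next
    case False
    let ?Ok = "{ms. ms \<in> ?O \<and> length ms = k}"
    have Sk: "{ms. ms \<in> S \<and> length ms = k} = ?Ok" using False by (auto simp: S_def)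
    have "sum ?t ?Ok = (-1) ^ (k + 1) / k * (\<Sum>ms\<in>?Ok. \<Sum>i<k. w (ms ! i) * (\<Prod>\<mu>\<leftarrow>ms. f \<mu>))"
      unfolding sum_distrib_left
    proof (rule sum.cong)
      fix ms assume "ms \<in> ?Ok"
      then have *: "w lam = (\<Sum>i<k. w (ms ! i))" "length ms = k"
        using wsum[of ms] by (auto simp: ordered_factorisations_def)
      show "?t ms = (\<Sum>i<k. (-1) ^ (k + 1) / k * (w (ms ! i) * (\<Prod>\<mu>\<leftarrow>ms. f \<mu>)))"
        unfolding * sum_distrib_left[symmetric] sum_distrib_right[symmetric] by simp
    qed simp
    also have "(\<Sum>ms\<in>?Ok. \<Sum>i<k. w (ms ! i) * (\<Prod>\<mu>\<leftarrow>ms. f \<mu>)) =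
        (\<Sum>i<k. \<Sum>ms\<in>?Ok. w (ms ! i) * (\<Prod>\<mu>\<leftarrow>ms. f \<mu>))"
      by (rule sum.swap)
    also have "\<dots> = (\<Sum>i<k. \<Sum>ms\<in>?Ok. w (hd ms) * (\<Prod>\<mu>\<leftarrow>ms. f \<mu>))"
      by (intro sum.cong refl sum_factorisations_rotate) simp
    also have "(-1) ^ (k + 1) / k * \<dots> = (\<Sum>ms\<in>?Ok. (-1) ^ (k + 1) * (w (hd ms) * (\<Prod>\<mu>\<leftarrow>ms. f \<mu>)))"
      using False by (simp add: sum_distrib_left)
    also have "\<dots> = sum ?s ?Ok"
      by (rule sum.cong) (auto simp: mult.assoc)
    finally show ?thesis by (simp only: Sk)
  qed
  have "w lam * log_coeff f lam = sum ?t ?O"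
    by (simp add: log_coeff_def sum_distrib_left)
  \<comment> \<open>The empty factorisation, present only for \<open>lam = {#}\<close>, drops out:
    its length is 0, and division by 0 yields 0.\<close>
  also have "\<dots> = sum ?t S"
    by (rule sum.mono_neutral_right) (auto simp: S_def finite_ordered_factorisations)
  also have "\<dots> = (\<Sum>k\<in>length ` S. \<Sum>ms | ms \<in> S \<and> length ms = k. ?t ms)"
    by (rule sum.group[symmetric]) (auto simp: fin)
  also have "\<dots> = (\<Sum>k\<in>length ` S. \<Sum>ms | ms \<in> S \<and> length ms = k. ?s ms)"
    by (simp only: level)
  also have "\<dots> = sum ?s S"
    by (rule sum.group) (auto simp: fin)
  finally show ?thesis by (simp only: S_def)
qed

text \<open>Appending a nonempty last factor reverses the sign, so all factorisations of length at least two
  cancel.\<close>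
lemma log_coeff_recursion:
  fixes w f :: "nat multiset \<Rightarrow> real"
  assumes w0: "w {#} = 0" and add: "\<And>\<mu> \<nu>. w (\<mu> + \<nu>) = w \<mu> + w \<nu>" and f0: "f {#} = 1"
  shows "w lam * f lam = (\<Sum>\<mu> | \<mu> \<subseteq># lam. w \<mu> * log_coeff f \<mu> * f (lam - \<mu>))"
proof (cases "lam = {#}")
  case True
  then show ?thesis by (simp add: w0)
next
  case False
  let ?O = ordered_factorisations
  let ?s = "\<lambda>ms. (-1) ^ (length ms + 1) * w (hd ms) * (\<Prod>\<mu>\<leftarrow>ms. f \<mu>) :: real"
  let ?L = "{ms \<in> ?O lam. 2 \<le> length ms}"
  note G = weight_times_log_coeff[of w _ f, OF w0 add]
  have "(\<Sum>\<mu> | \<mu> \<subset># lam. w \<mu> * log_coeff f \<mu> * f (lam - \<mu>)) =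
      (\<Sum>\<mu> | \<mu> \<subset># lam. \<Sum>ms\<in>?O \<mu> - {[]}. ?s ms * f (lam - \<mu>))"
    by (simp only: G sum_distrib_right)
  also have "\<dots> = (\<Sum>(\<mu>, ms)\<in>(SIGMA \<mu>:{\<mu>. \<mu> \<subset># lam}. ?O \<mu> - {[]}). ?s ms * f (lam - \<mu>))"
    by (rule sum.Sigma)
      (auto simp: finite_ordered_factorisations finite_strict_submultisets)
  \<comment> \<open>The factor \<open>f (lam - \<mu>)\<close> is absorbed as a new last entry. It is
    nonempty because \<mu> is a proper submultiset, and \<mu> is recovered as the sum of the other
    entries. As \<open>ms\<close> is nonempty, its head and hence the weight stay the same; the
    length grows by one, which flips the sign.\<close>
  also have "\<dots> = (\<Sum>ms\<in>?L. - ?s ms)"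
  proof (rule sum.reindex_bij_witness[where j="\<lambda>(\<mu>, ms). ms @ [lam - \<mu>]" and
        i="\<lambda>ms. (sum_list (butlast ms), butlast ms)"], goal_cases)
    case (1 a)
    then show ?case by (auto simp: ordered_factorisations_def)
  next
    case (2 a)
    obtain \<mu> ms where a: "a = (\<mu>, ms)" by (cases a)
    then have *: "\<mu> \<subset># lam" "\<forall>\<mu>\<in>set ms. \<mu> \<noteq> {#}" "sum_list ms = \<mu>" "ms \<noteq> []"
      using 2 by (auto simp: ordered_factorisations_def)
    then have "Suc 0 \<le> length ms" by (cases ms) auto
    moreover have "\<mu> + (lam - \<mu>) = lam" using *(1) by (simp add: subset_mset.less_imp_le)
    moreover have "lam - \<mu> \<noteq> {#}" using *(1)
      by (metis Diff_eq_empty_iff_mset subset_mset.less_le_not_le)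
    ultimately show ?case using * by (auto simp: ordered_factorisations_def a)
  next
    case (3 ms)
    then have ms: "ms \<noteq> []" "sum_list ms = lam" by (auto simp: ordered_factorisations_def)
    obtain ns \<nu> where ns: "ms = ns @ [\<nu>]" using ms by (metis append_butlast_last_id)
    show ?case using ms(2) by (auto simp: ns)
  next
    case (4 ms)
    then have ms: "ms \<noteq> []" "sum_list ms = lam" "\<forall>\<mu>\<in>set ms. \<mu> \<noteq> {#}" "2 \<le> length ms"
      by (auto simp: ordered_factorisations_def)
    obtain ns \<nu> where ns: "ms = ns @ [\<nu>]" using ms by (metis append_butlast_last_id)
    have "ns \<noteq> []" using ms(4) ns by auto
    moreover have "\<nu> \<noteq> {#}" using ms ns by auto
    ultimately show ?case using ms
      by (auto simp: ns ordered_factorisations_def subset_mset.less_le)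
  next
    case (5 a)
    then have "snd a \<noteq> []" by auto
    then have "hd (snd a @ [lam - fst a]) = hd (snd a)" by simp
    then show ?case by (simp add: case_prod_beta)
  qed
  finally have proper: "(\<Sum>\<mu> | \<mu> \<subset># lam. w \<mu> * log_coeff f \<mu> * f (lam - \<mu>)) = - (\<Sum>ms\<in>?L. ?s ms)"
    by (simp add: sum_negf)
  \<comment> \<open>The one-term factorisation \<open>[lam]\<close> is all that survives the
    cancellation; it supplies \<open>w lam * f lam\<close>.\<close>
  have split: "?O lam - {[]} = insert [lam] ?L"
  proof (intro equalityI subsetI)
    fix ms assume *: "ms \<in> ?O lam - {[]}"
    then obtain \<mu> ns where ms: "ms = \<mu> # ns" by (cases ms) auto
    show "ms \<in> insert [lam] ?L"
      using * by (cases ns) (auto simp: ms ordered_factorisations_def)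
  next
    fix ms assume "ms \<in> insert [lam] ?L"
    then show "ms \<in> ?O lam - {[]}" using False by (auto simp: ordered_factorisations_def)
  qed
  have "w lam * log_coeff f lam = w lam * f lam + (\<Sum>ms\<in>?L. ?s ms)"
    unfolding G split by (subst sum.insert) (auto simp: finite_ordered_factorisations)
  moreover have "{\<mu>. \<mu> \<subseteq># lam} = insert lam {\<mu>. \<mu> \<subset># lam}"
    by (auto simp: subset_mset.le_less)
  ultimately show ?thesis using proper by (simp add: f0 finite_strict_submultisets)
qed

text \<open>In the recursion the term at \<open>lam\<close> itself has the factor
  \<open>f {#} = 1\<close>, and all other terms involve smaller multisets, so induction on the size
  determines the weighted coefficients. The weight cannot be cancelled here, since it may
  vanish.\<close>

lemma log_coeff_unique:
  fixes w f c :: "nat multiset \<Rightarrow> real"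
  assumes w0: "w {#} = 0" and add: "\<And>\<mu> \<nu>. w (\<mu> + \<nu>) = w \<mu> + w \<nu>" and f0: "f {#} = 1"
    and c: "\<And>lam. w lam * f lam = (\<Sum>\<mu> | \<mu> \<subseteq># lam. w \<mu> * c \<mu> * f (lam - \<mu>))"
  shows "w lam * log_coeff f lam = w lam * c lam"
proof (induction lam rule: measure_induct_rule[of size])
  case (less lam)
  have split: "{\<mu>. \<mu> \<subseteq># lam} = insert lam {\<mu>. \<mu> \<subset># lam}"
    by (auto simp: subset_mset.le_less)
  have "(\<Sum>\<mu> | \<mu> \<subseteq># lam. w \<mu> * log_coeff f \<mu> * f (lam - \<mu>)) =
      (\<Sum>\<mu> | \<mu> \<subseteq># lam. w \<mu> * c \<mu> * f (lam - \<mu>))"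
    using log_coeff_recursion[of w f lam, OF w0 add f0] c[of lam] by simp
  moreover have "(\<Sum>\<mu> | \<mu> \<subset># lam. w \<mu> * log_coeff f \<mu> * f (lam - \<mu>)) =
      (\<Sum>\<mu> | \<mu> \<subset># lam. w \<mu> * c \<mu> * f (lam - \<mu>))"
    by (intro sum.cong refl) (simp add: less mset_subset_size)
  ultimately show ?case by (simp add: split finite_strict_submultisets f0)
qed

section \<open>Components of a pair of permutations\<close>

lemma permutesI_bij: "bij p \<Longrightarrow> (\<And>x. x \<notin> A \<Longrightarrow> p x = x) \<Longrightarrow> p permutes A"
  by (auto simp: permutes_def bij_iff)

text \<open>\<open>cycle_type\<close> over an arbitrary ground set, because the components of a pair
  on {1..n} live on other subsets.\<close>

definition orbit_sizes :: "nat set \<Rightarrow> (nat \<Rightarrow> nat) \<Rightarrow> nat multiset" where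
  "orbit_sizes A \<pi> = image_mset card (mset_set (orbit \<pi> ` A))"

lemma cycle_type_eq_orbit_sizes: "cycle_type n = orbit_sizes {1..n}"
  by (simp add: fun_eq_iff cycle_type_def orbit_sizes_def)

text \<open>Equivalences at all points, rather than inclusions of images, make the notion pass at
  once to differences, intersections and inverse maps.\<close>

definition stable_under :: "(nat \<Rightarrow> nat) \<Rightarrow> (nat \<Rightarrow> nat) \<Rightarrow> nat set \<Rightarrow> bool" where
  "stable_under \<sigma> \<rho> B \<longleftrightarrow> (\<forall>y. (\<sigma> y \<in> B \<longleftrightarrow> y \<in> B) \<and> (\<rho> y \<in> B \<longleftrightarrow> y \<in> B))"

text \<open>Transitivity on \<open>B\<close> expressed through invariant subsets; \<sigma> and
  \<rho> may act on a larger set, so the same predicate describes a single component.\<close>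

definition irreducible_on :: "(nat \<Rightarrow> nat) \<Rightarrow> (nat \<Rightarrow> nat) \<Rightarrow> nat set \<Rightarrow> bool" where
  "irreducible_on \<sigma> \<rho> B \<longleftrightarrow> (\<forall>E\<subseteq>B. stable_under \<sigma> \<rho> E \<longrightarrow> E = {} \<or> E = B)"

definition perm_pairs :: "nat set \<Rightarrow> nat multiset \<Rightarrow> ((nat \<Rightarrow> nat) \<times> (nat \<Rightarrow> nat)) set" where
  "perm_pairs A lam = {(\<sigma>, \<rho>). \<sigma> permutes A \<and> \<rho> permutes A \<and> orbit_sizes A (commutator \<sigma> \<rho>) = lam}"

definition connected_pairs :: "nat set \<Rightarrow> nat multiset \<Rightarrow> ((nat \<Rightarrow> nat) \<times> (nat \<Rightarrow> nat)) set" where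
  "connected_pairs A lam = {(\<sigma>, \<rho>) \<in> perm_pairs A lam. irreducible_on \<sigma> \<rho> A}"

lemma finite_perm_pairs: "finite A \<Longrightarrow> finite (perm_pairs A lam)"
  by (rule finite_subset[of _ "{\<sigma>. \<sigma> permutes A} \<times> {\<rho>. \<rho> permutes A}"])
    (auto simp: perm_pairs_def finite_permutations)

lemma finite_connected_pairs: "finite A \<Longrightarrow> finite (connected_pairs A lam)"
  by (rule finite_subset[OF _ finite_perm_pairs]) (auto simp: connected_pairs_def)

section \<open>Locality of commutators and cycle types on stable sets\<close>

lemma commutator_permutes: "\<sigma> permutes A \<Longrightarrow> \<rho> permutes A \<Longrightarrow> commutator \<sigma> \<rho> permutes A"
  unfolding commutator_def by (intro permutes_compose permutes_inv)

lemma stable_permutes: "\<sigma> permutes A \<Longrightarrow> \<rho> permutes A \<Longrightarrow> stable_under \<sigma> \<rho> A"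
  by (simp add: stable_under_def permutes_in_image)

lemma stable_diff: "stable_under \<sigma> \<rho> A \<Longrightarrow> stable_under \<sigma> \<rho> B \<Longrightarrow> stable_under \<sigma> \<rho> (A - B)"
  by (simp add: stable_under_def)

lemma inv_mem_iff:
  assumes "bij f" "\<And>y. f y \<in> B \<longleftrightarrow> y \<in> B"
  shows "inv f y \<in> B \<longleftrightarrow> y \<in> B"
  by (metis assms bij_inv_eq_iff)

lemma commutator_mem_iff:
  assumes "bij \<sigma>" "bij \<rho>" "stable_under \<sigma> \<rho> B"
  shows "commutator \<sigma> \<rho> y \<in> B \<longleftrightarrow> y \<in> B"
  using assms inv_mem_iff[of \<sigma> B] inv_mem_iff[of \<rho> B] by (simp add: commutator_def stable_under_def)

lemma inv_eq_on_stable: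
  assumes "bij f" "bij g" "\<And>y. f y \<in> B \<longleftrightarrow> y \<in> B" "\<And>y. y \<in> B \<Longrightarrow> f y = g y" "x \<in> B"
  shows "inv f x = inv g x"
  by (metis assms bij_inv_eq_iff)

text \<open>Evaluating the commutator at \<open>x\<close> takes four steps. All intermediate points
  stay in \<open>B\<close>, where the two pairs agree, and so do their inverses.\<close>

lemma commutator_eq_on_stable:
  assumes bij: "bij \<sigma>" "bij \<rho>" "bij \<sigma>'" "bij \<rho>'"
    and st: "stable_under \<sigma> \<rho> B" and eq: "\<And>y. y \<in> B \<Longrightarrow> \<sigma> y = \<sigma>' y" "\<And>y. y \<in> B \<Longrightarrow> \<rho> y = \<rho>' y"
    and x: "x \<in> B"
  shows "commutator \<sigma> \<rho> x = commutator \<sigma>' \<rho>' x"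
proof -
  have mem: "\<sigma> y \<in> B \<longleftrightarrow> y \<in> B" "\<rho> y \<in> B \<longleftrightarrow> y \<in> B" for y
    using st by (auto simp: stable_under_def)
  have 1: "inv \<rho> x = inv \<rho>' x" using bij(2,4) mem(2) eq(2) x by (rule inv_eq_on_stable)
  have 2: "inv \<rho> x \<in> B" using inv_mem_iff[OF bij(2) mem(2)] x by blast
  have 3: "inv \<sigma> (inv \<rho> x) = inv \<sigma>' (inv \<rho> x)"
    using bij(1,3) mem(1) eq(1) 2 by (rule inv_eq_on_stable)
  have 4: "inv \<sigma> (inv \<rho> x) \<in> B" using inv_mem_iff[OF bij(1) mem(1)] 2 by blast
  have "commutator \<sigma> \<rho> x = \<sigma> (\<rho> (inv \<sigma>' (inv \<rho>' x)))"
    using 1 3 by (simp add: commutator_def)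
  moreover have 5: "inv \<sigma>' (inv \<rho>' x) \<in> B" using 1 3 4 by simp
  moreover have "\<rho>' (inv \<sigma>' (inv \<rho>' x)) \<in> B" using mem(2) eq(2)[OF 5] 5 by metis
  ultimately show ?thesis by (simp add: commutator_def eq)
qed

lemma orbit_sizes_cong:
  assumes "\<And>y. y \<in> B \<Longrightarrow> f y \<in> B" "\<And>y. y \<in> B \<Longrightarrow> f y = g y"
  shows "orbit_sizes B f = orbit_sizes B g"
proof -
  have "orbit f ` B = orbit g ` B"
    by (intro image_cong refl orbit_cong0) (use assms in auto)
  then show ?thesis by (simp add: orbit_sizes_def)
qed

lemma orbit_sizes_union:
  assumes "finite B" "finite C" "B \<inter> C = {}"
    and B: "\<And>y. y \<in> B \<Longrightarrow> f y \<in> B" and C: "\<And>y. y \<in> C \<Longrightarrow> f y \<in> C"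
  shows "orbit_sizes (B \<union> C) f = orbit_sizes B f + orbit_sizes C f"
proof -
  have sub: "orbit f x \<subseteq> D" if "x \<in> D" "\<And>y. y \<in> D \<Longrightarrow> f y \<in> D" for x D
  proof
    fix y assume "y \<in> orbit f x" then show "y \<in> D" by induct (use that in auto)
  qed
  have "orbit f ` B \<inter> orbit f ` C = {}"
  proof (rule ccontr)
    assume "orbit f ` B \<inter> orbit f ` C \<noteq> {}"
    then obtain x y where xy: "x \<in> B" "y \<in> C" "orbit f x = orbit f y" by auto
    have "orbit f x \<subseteq> B" "orbit f y \<subseteq> C" using sub[OF xy(1) B] sub[OF xy(2) C] by auto
    \<comment> \<open>The witness is \<open>f x\<close>, not \<open>x\<close>: an orbit is generated
      from the first image, and \<open>x\<close> itself need not lie in it when \<open>f\<close> is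
      an arbitrary map.\<close>
    then have "f x \<in> B \<inter> C" using xy(3) orbit.base[of f x] by auto
    then show False using assms(3) by simp
  qed
  then show ?thesis using assms(1,2)
    by (simp add: orbit_sizes_def image_Un mset_set_Union)
qed

lemma orbit_eq_or_disjoint:
  assumes "permutation f" "orbit f x \<inter> orbit f y \<noteq> {}"
  shows "orbit f x = orbit f y"
proof -
  obtain z where "z \<in> orbit f x" "z \<in> orbit f y" using assms(2) by blast
  then show ?thesis
    using orbit_cyclic_eq3[OF cyclic_on_orbit'[OF assms(1)]] by metis
qed

lemma sum_mset_orbit_sizes:
  assumes "finite A" "\<pi> permutes A"
  shows "sum_mset (orbit_sizes A \<pi>) = card A"
proof -
  have perm: "permutation \<pi>" using assms by (auto simp: permutation_permutes)
  have "(\<Union>(orbit \<pi> ` A)) = A"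
    using permutes_orbit_subset[OF assms(2)] permutation_self_in_orbit[OF perm] by blast
  moreover have "card (\<Union>(orbit \<pi> ` A)) = sum card (orbit \<pi> ` A)"
  proof (rule card_Union_disjoint)
    show "disjoint (orbit \<pi> ` A)"
      unfolding disjoint_def using orbit_eq_or_disjoint[OF perm] by blast
    show "finite B" if "B \<in> orbit \<pi> ` A" for B
      using that permutation_self_in_orbit[OF perm] by (auto intro: finite_orbit)
  qed
  ultimately show ?thesis by (simp add: orbit_sizes_def sum_unfold_sum_mset)
qed

lemma irreducible_on_cong:
  assumes "stable_under \<sigma> \<rho> B" "stable_under \<sigma>' \<rho>' B" "\<And>y. y \<in> B \<Longrightarrow> \<sigma> y = \<sigma>' y" "\<And>y. y \<in> B \<Longrightarrow> \<rho> y = \<rho>' y"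
  shows "irreducible_on \<sigma> \<rho> B \<longleftrightarrow> irreducible_on \<sigma>' \<rho>' B"
proof -
  have "stable_under \<sigma> \<rho> E \<longleftrightarrow> stable_under \<sigma>' \<rho>' E" if "E \<subseteq> B" for E
  proof -
    have "\<sigma> y \<in> E \<longleftrightarrow> \<sigma>' y \<in> E" "\<rho> y \<in> E \<longleftrightarrow> \<rho>' y \<in> E" for y
      using assms that by (cases "y \<in> B"; auto simp: stable_under_def)+
    then show ?thesis by (simp add: stable_under_def)
  qed
  then show ?thesis by (auto simp: irreducible_on_def)
qed

text \<open>The component is the intersection of all stable subsets of \<open>A\<close> containing
  \<open>x\<close>. It is irreducible: a stable part avoiding \<open>x\<close> could be removed,
  contradicting minimality unless that part is empty. Any other candidate contains the intersection
  as a nonempty stable subset, hence equals it by its own irreducibility.\<close>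

lemma ex1_component:
  assumes "\<sigma> permutes A" "\<rho> permutes A" "x \<in> A"
  shows "\<exists>!B. B \<subseteq> A \<and> x \<in> B \<and> stable_under \<sigma> \<rho> B \<and> irreducible_on \<sigma> \<rho> B"
proof (rule ex1I)
  define B where "B = \<Inter>{B. B \<subseteq> A \<and> x \<in> B \<and> stable_under \<sigma> \<rho> B}"
  have A: "A \<in> {B. B \<subseteq> A \<and> x \<in> B \<and> stable_under \<sigma> \<rho> B}"
    using assms by (auto simp: stable_permutes)
  then have BA: "B \<subseteq> A" unfolding B_def by blast
  have xB: "x \<in> B" unfolding B_def by blast
  have st: "stable_under \<sigma> \<rho> B" unfolding B_def stable_under_def by auto
  have min: "B \<subseteq> E" if "E \<subseteq> A" "x \<in> E" "stable_under \<sigma> \<rho> E" for E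
    using that unfolding B_def by blast
  have "irreducible_on \<sigma> \<rho> B"
    unfolding irreducible_on_def
  proof (intro allI impI)
    fix E assume E: "E \<subseteq> B" "stable_under \<sigma> \<rho> E"
    show "E = {} \<or> E = B"
    proof (cases "x \<in> E")
      case True
      then show ?thesis using min[of E] E BA by blast
    next
      case False
      then have "B \<subseteq> B - E" using xB BA by (intro min stable_diff st E) auto
      then show ?thesis using E by blast
    qed
  qed
  then show "B \<subseteq> A \<and> x \<in> B \<and> stable_under \<sigma> \<rho> B \<and> irreducible_on \<sigma> \<rho> B"
    using BA xB st by blast
  fix C assume C: "C \<subseteq> A \<and> x \<in> C \<and> stable_under \<sigma> \<rho> C \<and> irreducible_on \<sigma> \<rho> C"
  have "B \<subseteq> C" using min C by blast
  then show "C = B" using C xB st unfolding irreducible_on_def by blast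
qed

section \<open>Cutting a pair along a stable set and gluing it back\<close>

lemma restrict_id_permutes:
  assumes "\<sigma> permutes A" "B \<subseteq> A" "\<And>y. \<sigma> y \<in> B \<longleftrightarrow> y \<in> B"
  shows "restrict_id \<sigma> B permutes B"
proof (rule permutes_restrict_id)
  have "\<sigma> ` B = B"
  proof (intro equalityI subsetI)
    fix y assume "y \<in> B"
    moreover obtain z where "y = \<sigma> z" using permutes_surj[OF assms(1)] by (rule surjE)
    ultimately show "y \<in> \<sigma> ` B" using assms(3) by simp
  qed (use assms(3) in auto)
  then show "bij_betw \<sigma> B B"
    using permutes_inj_on[OF assms(1)] by (simp add: bij_betw_def)
qed

text \<open>Disjoint supports make each composite act as its first factor on \<open>B\<close> and as
  its second on \<open>C\<close>. Both sets are therefore stable, and the commutator can be read off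
  on each separately.\<close>

lemma perm_pairs_union:
  assumes fin: "finite B" "finite C" and disj: "B \<inter> C = {}"
    and p: "\<sigma>1 permutes B" "\<rho>1 permutes B" "\<sigma>2 permutes C" "\<rho>2 permutes C"
  shows "\<sigma>1 \<circ> \<sigma>2 permutes B \<union> C" "\<rho>1 \<circ> \<rho>2 permutes B \<union> C"
    and "stable_under (\<sigma>1 \<circ> \<sigma>2) (\<rho>1 \<circ> \<rho>2) B"
    and "irreducible_on (\<sigma>1 \<circ> \<sigma>2) (\<rho>1 \<circ> \<rho>2) B \<longleftrightarrow> irreducible_on \<sigma>1 \<rho>1 B"
    and "orbit_sizes B (commutator (\<sigma>1 \<circ> \<sigma>2) (\<rho>1 \<circ> \<rho>2)) = orbit_sizes B (commutator \<sigma>1 \<rho>1)"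
    and "orbit_sizes (B \<union> C) (commutator (\<sigma>1 \<circ> \<sigma>2) (\<rho>1 \<circ> \<rho>2)) =
      orbit_sizes B (commutator \<sigma>1 \<rho>1) + orbit_sizes C (commutator \<sigma>2 \<rho>2)"
proof -
  let ?\<sigma> = "\<sigma>1 \<circ> \<sigma>2" and ?\<rho> = "\<rho>1 \<circ> \<rho>2"
  have onB: "?\<sigma> y = \<sigma>1 y" "?\<rho> y = \<rho>1 y" if "y \<in> B" for y
  proof -
    have "y \<notin> C" using that disj by blast
    then show "?\<sigma> y = \<sigma>1 y" "?\<rho> y = \<rho>1 y" using p by (auto simp: permutes_not_in)
  qed
  have onC: "?\<sigma> y = \<sigma>2 y" "?\<rho> y = \<rho>2 y" if "y \<in> C" for y
  proof -
    have "\<sigma>2 y \<notin> B" "\<rho>2 y \<notin> B" using that disj p by (auto simp: permutes_in_image)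
    then show "?\<sigma> y = \<sigma>2 y" "?\<rho> y = \<rho>2 y" using p by (auto simp: permutes_not_in)
  qed
  show perm: "?\<sigma> permutes B \<union> C" "?\<rho> permutes B \<union> C"
    using p by (auto intro!: permutes_compose intro: permutes_subset)
  have memC: "\<sigma>2 y \<in> B \<longleftrightarrow> y \<in> B" "\<rho>2 y \<in> B \<longleftrightarrow> y \<in> B" for y
    using p disj by (metis disjoint_iff permutes_in_image permutes_not_in)+
  show stB: "stable_under ?\<sigma> ?\<rho> B"
    using p by (simp add: stable_under_def permutes_in_image memC)
  have stC: "stable_under ?\<sigma> ?\<rho> C"
  proof -
    have "stable_under ?\<sigma> ?\<rho> (B \<union> C - B)" by (intro stable_diff stable_permutes perm stB)
    moreover have "B \<union> C - B = C" using disj by blast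
    ultimately show ?thesis by simp
  qed
  note bij = permutes_bij[OF perm(1)] permutes_bij[OF perm(2)]
  note bij1 = permutes_bij[OF p(1)] permutes_bij[OF p(2)]
  note bij2 = permutes_bij[OF p(3)] permutes_bij[OF p(4)]
  show "irreducible_on ?\<sigma> ?\<rho> B \<longleftrightarrow> irreducible_on \<sigma>1 \<rho>1 B"
    by (rule irreducible_on_cong[OF stB stable_permutes[OF p(1,2)]]) (use onB in auto)
  show B: "orbit_sizes B (commutator ?\<sigma> ?\<rho>) = orbit_sizes B (commutator \<sigma>1 \<rho>1)"
    using commutator_mem_iff[OF bij stB]
    by (intro orbit_sizes_cong commutator_eq_on_stable[OF bij bij1 stB] onB) auto
  have C: "orbit_sizes C (commutator ?\<sigma> ?\<rho>) = orbit_sizes C (commutator \<sigma>2 \<rho>2)"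
    using commutator_mem_iff[OF bij stC]
    by (intro orbit_sizes_cong commutator_eq_on_stable[OF bij bij2 stC] onC) auto
  show "orbit_sizes (B \<union> C) (commutator ?\<sigma> ?\<rho>) =
      orbit_sizes B (commutator \<sigma>1 \<rho>1) + orbit_sizes C (commutator \<sigma>2 \<rho>2)"
    unfolding B[symmetric] C[symmetric]
    using commutator_mem_iff[OF bij stB] commutator_mem_iff[OF bij stC]
    by (intro orbit_sizes_union fin disj) auto
qed

lemma restrict_id_comp:
  assumes "\<sigma> permutes B \<union> C" "B \<inter> C = {}" "\<And>y. \<sigma> y \<in> B \<longleftrightarrow> y \<in> B"
  shows "restrict_id \<sigma> B \<circ> restrict_id \<sigma> C = \<sigma>"
proof
  fix x
  show "(restrict_id \<sigma> B \<circ> restrict_id \<sigma> C) x = \<sigma> x"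
    using assms permutes_not_in[OF assms(1), of x]
    by (cases "x \<in> B"; cases "x \<in> C") (auto simp: restrict_id_def)
qed

lemma restrict_id_of_comp:
  assumes "\<sigma>1 permutes B" "\<sigma>2 permutes C" "B \<inter> C = {}"
  shows "restrict_id (\<sigma>1 \<circ> \<sigma>2) B = \<sigma>1" "restrict_id (\<sigma>1 \<circ> \<sigma>2) C = \<sigma>2"
proof -
  have "\<sigma>2 x \<notin> B" if "x \<in> C" for x using that assms by (auto simp: permutes_in_image)
  moreover have "x \<notin> C" if "x \<in> B" for x using that assms by auto
  ultimately show "restrict_id (\<sigma>1 \<circ> \<sigma>2) B = \<sigma>1" "restrict_id (\<sigma>1 \<circ> \<sigma>2) C = \<sigma>2"
    using permutes_not_in[OF assms(1)] permutes_not_in[OF assms(2)]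
    by (auto simp: fun_eq_iff restrict_id_def)
qed

text \<open>Restriction to \<open>B\<close> and \<open>A - B\<close> is inverse to composition, and
  the cycle type of the commutator is the sum of those of the two parts. The index \<mu> is the
  share that belongs to \<open>B\<close>.\<close>

lemma card_perm_pairs_component:
  assumes fin: "finite A" and BA: "B \<subseteq> A"
  shows "card {(\<sigma>, \<rho>) \<in> perm_pairs A lam. stable_under \<sigma> \<rho> B \<and> irreducible_on \<sigma> \<rho> B} =
    (\<Sum>\<mu> | \<mu> \<subseteq># lam. card (connected_pairs B \<mu>) * card (perm_pairs (A - B) (lam - \<mu>)))"
proof -
  define C where "C = A - B"
  have A: "A = B \<union> C" and disj: "B \<inter> C = {}" using BA by (auto simp: C_def)
  have finB: "finite B" and finC: "finite C" using fin by (auto simp: A)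
  define R where "R = {(\<sigma>, \<rho>) \<in> perm_pairs A lam. stable_under \<sigma> \<rho> B \<and> irreducible_on \<sigma> \<rho> B}"
  define S where "S = (SIGMA \<mu>:{\<mu>. \<mu> \<subseteq># lam}. connected_pairs B \<mu> \<times> perm_pairs C (lam - \<mu>))"
  define glue where "glue = (\<lambda>(\<mu> :: nat multiset, (\<sigma>1 :: nat \<Rightarrow> nat, \<rho>1 :: nat \<Rightarrow> nat),
    (\<sigma>2 :: nat \<Rightarrow> nat, \<rho>2 :: nat \<Rightarrow> nat)). (\<sigma>1 \<circ> \<sigma>2, \<rho>1 \<circ> \<rho>2))"
  define cut where "cut = (\<lambda>(\<sigma>, \<rho>). (orbit_sizes B (commutator \<sigma> \<rho>),
    (restrict_id \<sigma> B, restrict_id \<rho> B), (restrict_id \<sigma> C, restrict_id \<rho> C)))"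
  note union = perm_pairs_union[OF finB finC disj]
  have glue_cut: "glue s \<in> R \<and> cut (glue s) = s" if "s \<in> S" for s
  proof -
    obtain \<mu> \<sigma>1 \<rho>1 \<sigma>2 \<rho>2 where s: "s = (\<mu>, (\<sigma>1, \<rho>1), (\<sigma>2, \<rho>2))"
      by (cases s) auto
    have "\<mu> \<subseteq># lam" and p: "\<sigma>1 permutes B" "\<rho>1 permutes B" "\<sigma>2 permutes C" "\<rho>2 permutes C"
      and "irreducible_on \<sigma>1 \<rho>1 B" and os: "orbit_sizes B (commutator \<sigma>1 \<rho>1) = \<mu>"
      "orbit_sizes C (commutator \<sigma>2 \<rho>2) = lam - \<mu>"
      using that by (auto simp: s S_def connected_pairs_def perm_pairs_def)
    then show ?thesis using union[OF p]
      by (simp add: s R_def glue_def cut_def perm_pairs_def A os restrict_id_of_comp[OF p(1,3) disj] restrict_id_of_comp[OF p(2,4) disj]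
          cong del: restrict_id_cong)
  qed
  have cut_glue: "cut r \<in> S \<and> glue (cut r) = r" if "r \<in> R" for r
  proof -
    obtain \<sigma> \<rho> where r: "r = (\<sigma>, \<rho>)" by (cases r)
    have p: "\<sigma> permutes A" "\<rho> permutes A" and st: "stable_under \<sigma> \<rho> B" and irr: "irreducible_on \<sigma> \<rho> B"
      and os: "orbit_sizes A (commutator \<sigma> \<rho>) = lam"
      using that by (auto simp: r R_def perm_pairs_def)
    have stC: "stable_under \<sigma> \<rho> C" unfolding C_def by (intro stable_diff stable_permutes p st)
    have q: "restrict_id \<sigma> B permutes B" "restrict_id \<rho> B permutes B"
      "restrict_id \<sigma> C permutes C" "restrict_id \<rho> C permutes C"
      using st stC p A by (auto intro!: restrict_id_permutes[where A=A] simp: stable_under_def)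
    have eq: "restrict_id \<sigma> B \<circ> restrict_id \<sigma> C = \<sigma>" "restrict_id \<rho> B \<circ> restrict_id \<rho> C = \<rho>"
      using st p disj by (auto intro!: restrict_id_comp simp: A stable_under_def)
    have sum: "lam = orbit_sizes B (commutator \<sigma> \<rho>) + orbit_sizes C (commutator (restrict_id \<sigma> C) (restrict_id \<rho> C))"
      using union(5,6)[OF q] os unfolding eq by (simp add: A)
    show ?thesis
      using union(4,5)[OF q] irr sum q unfolding eq
      by (simp add: r eq S_def glue_def cut_def connected_pairs_def perm_pairs_def)
  qed
  have "bij_betw glue S R"
    by (rule bij_betw_byWitness[where f'=cut]) (use glue_cut cut_glue in blast)+
  then have "card R = card S" by (simp add: bij_betw_same_card)
  also have "card S = (\<Sum>\<mu> | \<mu> \<subseteq># lam. card (connected_pairs B \<mu> \<times> perm_pairs C (lam - \<mu>)))"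
    unfolding S_def by (rule card_SigmaI)
      (auto simp: finite_submultisets finite_connected_pairs finite_perm_pairs finB finC)
  finally show ?thesis by (simp add: card_cartesian_product R_def C_def)
qed

text \<open>Pairs are classified by the component \<open>B\<close> of the marked point
  \<open>x\<close>; its existence and uniqueness make the classes a disjoint cover.\<close>

lemma card_perm_pairs_recursion:
  assumes fin: "finite A" and x: "x \<in> A"
  shows "card (perm_pairs A lam) = (\<Sum>B | B \<subseteq> A \<and> x \<in> B. \<Sum>\<mu> | \<mu> \<subseteq># lam.
    card (connected_pairs B \<mu>) * card (perm_pairs (A - B) (lam - \<mu>)))"
proof -
  let ?R = "\<lambda>B. {(\<sigma>, \<rho>) \<in> perm_pairs A lam. stable_under \<sigma> \<rho> B \<and> irreducible_on \<sigma> \<rho> B}"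
  have "perm_pairs A lam = (\<Union>B\<in>{B. B \<subseteq> A \<and> x \<in> B}. ?R B)"
  proof (intro equalityI subsetI)
    fix r assume r: "r \<in> perm_pairs A lam"
    obtain \<sigma> \<rho> where "r = (\<sigma>, \<rho>)" by (cases r)
    then show "r \<in> (\<Union>B\<in>{B. B \<subseteq> A \<and> x \<in> B}. ?R B)"
      using r ex1_component[of \<sigma> A \<rho> x] x by (auto simp: perm_pairs_def)
  qed auto
  also have "card \<dots> = (\<Sum>B | B \<subseteq> A \<and> x \<in> B. card (?R B))"
  proof (rule card_UN_disjoint)
    show "finite {B. B \<subseteq> A \<and> x \<in> B}" using fin by auto
    show "\<forall>B\<in>{B. B \<subseteq> A \<and> x \<in> B}. finite (?R B)"
      by (auto intro: finite_subset[OF _ finite_perm_pairs[OF fin]])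
    show "\<forall>B\<in>{B. B \<subseteq> A \<and> x \<in> B}. \<forall>C\<in>{B. B \<subseteq> A \<and> x \<in> B}. B \<noteq> C \<longrightarrow> ?R B \<inter> ?R C = {}"
    proof (intro ballI impI)
      fix B C assume BC: "B \<in> {B. B \<subseteq> A \<and> x \<in> B}" "C \<in> {B. B \<subseteq> A \<and> x \<in> B}" "B \<noteq> C"
      show "?R B \<inter> ?R C = {}"
      proof (rule equals0I)
        fix r assume r: "r \<in> ?R B \<inter> ?R C"
        obtain \<sigma> \<rho> where "r = (\<sigma>, \<rho>)" by (cases r)
        with r have "\<sigma> permutes A" "\<rho> permutes A" "stable_under \<sigma> \<rho> B \<and> irreducible_on \<sigma> \<rho> B"
          "stable_under \<sigma> \<rho> C \<and> irreducible_on \<sigma> \<rho> C"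
          by (auto simp: perm_pairs_def)
        then show False using ex1_component[of \<sigma> A \<rho> x] x BC by blast
      qed
    qed
  qed
  also have "\<dots> = (\<Sum>B | B \<subseteq> A \<and> x \<in> B. \<Sum>\<mu> | \<mu> \<subseteq># lam.
    card (connected_pairs B \<mu>) * card (perm_pairs (A - B) (lam - \<mu>)))"
    by (intro sum.cong refl card_perm_pairs_component fin) simp
  finally show ?thesis .
qed

section \<open>Connected pairs and the exponential formula\<close>

definition conj_by :: "(nat \<Rightarrow> nat) \<Rightarrow> (nat \<Rightarrow> nat) \<Rightarrow> nat \<Rightarrow> nat" where
  "conj_by p \<sigma> = p \<circ> \<sigma> \<circ> inv p"

lemma conj_by_apply: "bij p \<Longrightarrow> conj_by p \<sigma> (p x) = p (\<sigma> x)"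
  by (simp add: conj_by_def bij_is_inj)

lemma conj_by_permutes:
  assumes "bij p" "\<sigma> permutes A"
  shows "conj_by p \<sigma> permutes p ` A"
proof (rule permutesI_bij)
  show "bij (conj_by p \<sigma>)"
    unfolding conj_by_def using assms by (intro bij_comp bij_imp_bij_inv) (auto simp: permutes_bij)
  fix x assume "x \<notin> p ` A"
  moreover obtain y where "x = p y" using assms(1) by (metis bij_pointE)
  ultimately have "y \<notin> A" "conj_by p \<sigma> x = p (\<sigma> y)" using assms(1) by (auto simp: conj_by_apply)
  then show "conj_by p \<sigma> x = x" using assms(2) \<open>x = p y\<close> by (simp add: permutes_not_in)
qed

lemma inv_conj_by:
  assumes "bij p" "bij \<sigma>"
  shows "inv (conj_by p \<sigma>) = conj_by p (inv \<sigma>)"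
  unfolding conj_by_def using assms
  by (simp add: o_inv_distrib bij_comp bij_imp_bij_inv inv_inv_eq o_assoc)

lemma conj_by_comp:
  assumes "bij p"
  shows "conj_by p \<sigma> \<circ> conj_by p \<rho> = conj_by p (\<sigma> \<circ> \<rho>)"
  using assms by (auto simp: conj_by_def fun_eq_iff bij_is_inj)

lemma commutator_conj_by:
  assumes "bij p" "bij \<sigma>" "bij \<rho>"
  shows "commutator (conj_by p \<sigma>) (conj_by p \<rho>) = conj_by p (commutator \<sigma> \<rho>)"
  using assms by (simp add: commutator_def inv_conj_by conj_by_comp)

lemma orbit_sizes_conj_by:
  assumes p: "bij p" and \<pi>: "permutation \<pi>"
  shows "orbit_sizes (p ` A) (conj_by p \<pi>) = orbit_sizes A \<pi>"
proof -
  have "orbit (conj_by p \<pi>) (p x) = p ` orbit \<pi> x" for x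
    by (rule orbit_inverse[symmetric])
      (auto simp: permutation_self_in_orbit[OF \<pi>] conj_by_apply[OF p])
  then have "orbit (conj_by p \<pi>) ` p ` A = image p ` orbit \<pi> ` A"
    by (simp add: image_image)
  moreover have "inj_on (image p) (orbit \<pi> ` A)"
    using p by (auto intro!: inj_onI simp: inj_image_eq_iff bij_is_inj)
  ultimately have "orbit_sizes (p ` A) (conj_by p \<pi>) =
      image_mset card (image_mset (image p) (mset_set (orbit \<pi> ` A)))"
    by (simp add: orbit_sizes_def image_mset_mset_set)
  also have "\<dots> = image_mset (\<lambda>B. card (p ` B)) (mset_set (orbit \<pi> ` A))"
    by (simp add: multiset.map_comp comp_def)
  also have "\<dots> = orbit_sizes A \<pi>"
    using p by (simp add: orbit_sizes_def card_image bij_is_inj inj_on_subset[OF _ subset_UNIV])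
  finally show ?thesis .
qed

lemma irreducible_on_conj_by:
  assumes p: "bij p" and irr: "irreducible_on \<sigma> \<rho> A"
  shows "irreducible_on (conj_by p \<sigma>) (conj_by p \<rho>) (p ` A)"
  unfolding irreducible_on_def
proof (intro allI impI)
  fix E assume E: "E \<subseteq> p ` A" "stable_under (conj_by p \<sigma>) (conj_by p \<rho>) E"
  have "p -` E \<subseteq> A" using E(1) p by (auto dest!: subsetD simp: bij_is_inj inj_eq)
  moreover have "stable_under \<sigma> \<rho> (p -` E)"
    using E(2) unfolding stable_under_def by (metis conj_by_apply[OF p] vimage_eq)
  ultimately have "p -` E = {} \<or> p -` E = A"
    using irr by (simp add: irreducible_on_def)
  moreover have "p ` (p -` E) = E" using p by (simp add: bij_is_surj surj_image_vimage_eq)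
  ultimately show "E = {} \<or> E = p ` A" by (metis image_empty)
qed

lemma conj_by_mem_pairs:
  assumes "bij p" "finite A"
  shows "(\<sigma>, \<rho>) \<in> perm_pairs A lam \<Longrightarrow> (conj_by p \<sigma>, conj_by p \<rho>) \<in> perm_pairs (p ` A) lam"
    and "(\<sigma>, \<rho>) \<in> connected_pairs A lam \<Longrightarrow> (conj_by p \<sigma>, conj_by p \<rho>) \<in> connected_pairs (p ` A) lam"
proof -
  show *: "(conj_by p \<sigma>, conj_by p \<rho>) \<in> perm_pairs (p ` A) lam" if "(\<sigma>, \<rho>) \<in> perm_pairs A lam"
  proof -
    have q: "\<sigma> permutes A" "\<rho> permutes A" and os: "orbit_sizes A (commutator \<sigma> \<rho>) = lam"
      using that by (auto simp: perm_pairs_def)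
    have "permutation (commutator \<sigma> \<rho>)"
      using commutator_permutes[OF q] assms(2) by (auto simp: permutation_permutes)
    then show ?thesis using q os
      by (simp add: perm_pairs_def conj_by_permutes assms commutator_conj_by permutes_bij orbit_sizes_conj_by)
  qed
  show "(conj_by p \<sigma>, conj_by p \<rho>) \<in> connected_pairs (p ` A) lam" if "(\<sigma>, \<rho>) \<in> connected_pairs A lam"
    using that * irreducible_on_conj_by[OF assms(1)] by (auto simp: connected_pairs_def)
qed

lemma inj_conj_by:
  assumes "bij p"
  shows "inj (conj_by p)"
proof (rule injI)
  fix \<sigma> \<rho> assume "conj_by p \<sigma> = conj_by p \<rho>"
  then have "p (\<sigma> x) = p (\<rho> x)" for x using conj_by_apply[OF assms] by metis
  then show "\<sigma> = \<rho>" using assms by (auto simp: fun_eq_iff bij_is_inj inj_eq)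
qed

text \<open>A bijection from \<open>A\<close> to \<open>B\<close> extends to all natural numbers,
  since the complements of finite sets are both countably infinite. A global bijection is wanted
  because permutations of \<open>A\<close> are total functions that fix the points outside
  \<open>A\<close>, and conjugation has to preserve this.\<close>

lemma ex_bij_image:
  fixes A B :: "nat set"
  assumes "finite A" "finite B" "card A = card B"
  obtains p where "bij p" "p ` A = B"
proof -
  obtain f where f: "bij_betw f A B" using assms finite_same_card_bij by blast
  have "infinite (- A)" "infinite (- B)" using assms by (simp_all add: finite_compl)
  then obtain a b where "bij_betw a (UNIV :: nat set) (- A)" "bij_betw b (UNIV :: nat set) (- B)"
    using bij_enumerate by blast
  then obtain g where g: "bij_betw g (- A) (- B)"
    using bij_betw_inv_into bij_betw_trans by blast
  let ?p = "\<lambda>x. if x \<in> A then f x else g x"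
  have "bij_betw ?p (A \<union> - A) (B \<union> - B)"
    by (rule bij_betw_disjoint_Un) (use f g in auto)
  moreover have "?p ` A = B" using f by (auto simp: bij_betw_def)
  ultimately show ?thesis using that[of ?p] by simp
qed

text \<open>Conjugation by a bijection carrying \<open>A\<close> to \<open>B\<close> is injective on
  pairs. Inequalities suffice, as the roles of \<open>A\<close> and \<open>B\<close> can be
  exchanged.\<close>

lemma card_pairs_le:
  assumes "finite A" "finite B" "card A = card B"
  shows "card (perm_pairs A lam) \<le> card (perm_pairs B lam)"
    and "card (connected_pairs A lam) \<le> card (connected_pairs B lam)"
proof -
  obtain p where p: "bij p" "p ` A = B" using ex_bij_image[OF assms] .
  have inj: "inj (map_prod (conj_by p) (conj_by p))"
    by (intro prod.inj_map inj_conj_by p)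
  show "card (perm_pairs A lam) \<le> card (perm_pairs B lam)"
    by (rule card_inj_on_le[OF inj_on_subset[OF inj subset_UNIV]])
      (use conj_by_mem_pairs(1)[OF p(1) assms(1)] p(2) finite_perm_pairs[OF assms(2)] in auto)
  show "card (connected_pairs A lam) \<le> card (connected_pairs B lam)"
    by (rule card_inj_on_le[OF inj_on_subset[OF inj subset_UNIV]])
      (use conj_by_mem_pairs(2)[OF p(1) assms(1)] p(2) finite_connected_pairs[OF assms(2)] in auto)
qed

lemma card_pairs_eq:
  assumes "finite A" "finite B" "card A = card B"
  shows "card (perm_pairs A lam) = card (perm_pairs B lam)"
    and "card (connected_pairs A lam) = card (connected_pairs B lam)"
  using assms by (auto intro!: antisym card_pairs_le)

section \<open>From components to the numerical recursion\<close>

lemma card_subsets_containing: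
  assumes "finite A" "x \<in> A" "0 < k"
  shows "card {B. B \<subseteq> A \<and> x \<in> B \<and> card B = k} = (card A - 1) choose (k - 1)"
proof -
  have "bij_betw (insert x) {B. B \<subseteq> A - {x} \<and> card B = k - 1} {B. B \<subseteq> A \<and> x \<in> B \<and> card B = k}"
  proof (rule bij_betw_byWitness[where f'="\<lambda>B. B - {x}"])
    show "\<forall>B\<in>{B. B \<subseteq> A - {x} \<and> card B = k - 1}. insert x B - {x} = B" by blast
    show "\<forall>B\<in>{B. B \<subseteq> A \<and> x \<in> B \<and> card B = k}. insert x (B - {x}) = B" by blast
    show "insert x ` {B. B \<subseteq> A - {x} \<and> card B = k - 1} \<subseteq> {B. B \<subseteq> A \<and> x \<in> B \<and> card B = k}"
    proof
      fix C assume "C \<in> insert x ` {B. B \<subseteq> A - {x} \<and> card B = k - 1}"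
      then obtain B where B: "C = insert x B" "B \<subseteq> A - {x}" "card B = k - 1" by auto
      then have "finite B" "x \<notin> B" using assms(1) by (auto intro: finite_subset)
      then show "C \<in> {B. B \<subseteq> A \<and> x \<in> B \<and> card B = k}" using B assms by auto
    qed
    show "(\<lambda>B. B - {x}) ` {B. B \<subseteq> A \<and> x \<in> B \<and> card B = k} \<subseteq> {B. B \<subseteq> A - {x} \<and> card B = k - 1}"
      by auto
  qed
  then have "card {B. B \<subseteq> A \<and> x \<in> B \<and> card B = k} = card {B. B \<subseteq> A - {x} \<and> card B = k - 1}"
    by (simp add: bij_betw_same_card)
  then show ?thesis using assms by (simp add: n_subsets)
qed

lemma connected_pairs_card:
  assumes "finite B" "connected_pairs B \<mu> \<noteq> {}"
  shows "sum_mset \<mu> = card B"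
proof -
  obtain \<sigma> \<rho> where "\<sigma> permutes B" "\<rho> permutes B" "orbit_sizes B (commutator \<sigma> \<rho>) = \<mu>"
    using assms(2) by (auto simp: connected_pairs_def perm_pairs_def)
  then show ?thesis using sum_mset_orbit_sizes[OF assms(1) commutator_permutes] by blast
qed

text \<open>With 1 as marked point, a component \<open>B\<close> contributes only if its cardinality
  is the sum of \<mu>, and then its contribution depends on that cardinality alone; the binomial
  coefficient counts such \<open>B\<close>. The case of sum 0 is separated because no set containing
  1 is empty, whereas the truncated difference \<open>0 - 1\<close> would give the binomial
  coefficient 1.\<close>

lemma card_perm_pairs_recursion_nat:
  assumes n: "n = sum_mset lam" "0 < n"
  shows "card (perm_pairs {1..n} lam) = (\<Sum>\<mu> | \<mu> \<subseteq># lam. if sum_mset \<mu> = 0 then 0 else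
    ((n - 1) choose (sum_mset \<mu> - 1)) * card (connected_pairs {1..sum_mset \<mu>} \<mu>) *
      card (perm_pairs {1..sum_mset (lam - \<mu>)} (lam - \<mu>)))"
proof -
  let ?A = "{1..n}"
  have "card (perm_pairs ?A lam) = (\<Sum>\<mu> | \<mu> \<subseteq># lam. \<Sum>B | B \<subseteq> ?A \<and> 1 \<in> B.
      card (connected_pairs B \<mu>) * card (perm_pairs (?A - B) (lam - \<mu>)))"
    using n card_perm_pairs_recursion[of ?A 1 lam] by (subst sum.swap) auto
  also have "\<dots> = (\<Sum>\<mu> | \<mu> \<subseteq># lam. if sum_mset \<mu> = 0 then 0 else
    ((n - 1) choose (sum_mset \<mu> - 1)) * card (connected_pairs {1..sum_mset \<mu>} \<mu>) *
      card (perm_pairs {1..sum_mset (lam - \<mu>)} (lam - \<mu>)))"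
  proof (intro sum.cong refl)
    fix \<mu> assume "\<mu> \<in> {\<mu>. \<mu> \<subseteq># lam}"
    then have \<mu>: "\<mu> \<subseteq># lam" by simp
    let ?k = "sum_mset \<mu>"
    have k: "sum_mset (lam - \<mu>) = n - ?k" "?k \<le> n"
      using \<mu> by (metis n(1) add_diff_cancel_left' subset_mset.add_diff_inverse sum_mset.union)
        (metis \<mu> n(1) le_add1 subset_mset.add_diff_inverse sum_mset.union)
    have fin: "finite B" if "B \<subseteq> ?A" for B using that by (rule finite_subset) simp
    have "(\<Sum>B | B \<subseteq> ?A \<and> 1 \<in> B. card (connected_pairs B \<mu>) * card (perm_pairs (?A - B) (lam - \<mu>))) =
        (\<Sum>B | B \<subseteq> ?A \<and> 1 \<in> B \<and> card B = ?k. card (connected_pairs B \<mu>) * card (perm_pairs (?A - B) (lam - \<mu>)))"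
    proof (rule sum.mono_neutral_right)
      show "\<forall>B\<in>{B. B \<subseteq> ?A \<and> 1 \<in> B} - {B. B \<subseteq> ?A \<and> 1 \<in> B \<and> card B = ?k}.
          card (connected_pairs B \<mu>) * card (perm_pairs (?A - B) (lam - \<mu>)) = 0"
      proof
        fix B assume "B \<in> {B. B \<subseteq> ?A \<and> 1 \<in> B} - {B. B \<subseteq> ?A \<and> 1 \<in> B \<and> card B = ?k}"
        then have "finite B" "?k \<noteq> card B" using fin by auto
        then have "connected_pairs B \<mu> = {}" using connected_pairs_card by blast
        then show "card (connected_pairs B \<mu>) * card (perm_pairs (?A - B) (lam - \<mu>)) = 0" by simp
      qed
    qed auto
    also have "\<dots> = (\<Sum>B | B \<subseteq> ?A \<and> 1 \<in> B \<and> card B = ?k.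
        card (connected_pairs {1..?k} \<mu>) * card (perm_pairs {1..sum_mset (lam - \<mu>)} (lam - \<mu>)))"
    proof (intro sum.cong refl)
      fix B assume "B \<in> {B. B \<subseteq> ?A \<and> 1 \<in> B \<and> card B = ?k}"
      then have B: "B \<subseteq> ?A" "card B = ?k" by auto
      have "card (?A - B) = sum_mset (lam - \<mu>)"
        using B fin[OF B(1)] k by (simp add: card_Diff_subset)
      then show "card (connected_pairs B \<mu>) * card (perm_pairs (?A - B) (lam - \<mu>)) =
          card (connected_pairs {1..?k} \<mu>) * card (perm_pairs {1..sum_mset (lam - \<mu>)} (lam - \<mu>))"
        using card_pairs_eq(1)[of "?A - B" "{1..sum_mset (lam - \<mu>)}"]
          card_pairs_eq(2)[OF fin[OF B(1)], of "{1..?k}"] B by simp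
    qed
    also have "\<dots> = (if ?k = 0 then 0 else
        ((n - 1) choose (?k - 1)) * card (connected_pairs {1..?k} \<mu>) *
          card (perm_pairs {1..sum_mset (lam - \<mu>)} (lam - \<mu>)))"
    proof (cases "?k = 0")
      case True
      have "card B \<noteq> ?k" if "B \<subseteq> ?A" "1 \<in> B" for B
        unfolding True using that fin[of B] by auto
      then have "{B. B \<subseteq> ?A \<and> 1 \<in> B \<and> card B = ?k} = {}" by blast
      then show ?thesis using True by (simp only: sum.empty simp_thms if_True)
    next
      case False
      then have pos: "0 < ?k" by (rule neq0_conv[THEN iffD1])
      have "1 \<in> ?A" using n(2) by simp
      from card_subsets_containing[OF finite_atLeastAtMost this pos] show ?thesis
        unfolding sum_constant using False
        by (simp only: card_atLeastAtMost if_False of_nat_id diff_Suc_1 mult.assoc)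
    qed
    finally show "(\<Sum>B | B \<subseteq> ?A \<and> 1 \<in> B. card (connected_pairs B \<mu>) * card (perm_pairs (?A - B) (lam - \<mu>))) =
        (if ?k = 0 then 0 else ((n - 1) choose (?k - 1)) * card (connected_pairs {1..?k} \<mu>) *
          card (perm_pairs {1..sum_mset (lam - \<mu>)} (lam - \<mu>)))" .
  qed
  finally show ?thesis .
qed

lemma hcirc_eq: "hcirc lam = card (perm_pairs {1..sum_mset lam} lam) / fact (sum_mset lam)"
  by (simp add: hcirc_def perm_pairs_def cycle_type_eq_orbit_sizes Let_def)

text \<open>The logarithmic coefficients and the normalised connected counts satisfy the same
  recursion for the weight |\<lambda>|, which can be cancelled for positive size. At
  \<open>{#}\<close> the two differ: the logarithm has constant term 0, while the pair of identities
  on the empty set counts as connected.\<close>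

lemma hcoef_eq_connected:
  assumes "0 < sum_mset lam"
  shows "hcoef lam = card (connected_pairs {1..sum_mset lam} lam) / fact (sum_mset lam)"
proof -
  define s where "s = (sum_mset :: nat multiset \<Rightarrow> nat)"
  define w where "w \<mu> = real (s \<mu>)" for \<mu>
  define c where "c \<mu> = real (card (connected_pairs {1..s \<mu>} \<mu>)) / fact (s \<mu>)" for \<mu>
  have hcirc: "hcirc \<mu> = card (perm_pairs {1..s \<mu>} \<mu>) / fact (s \<mu>)" for \<mu>
    by (simp add: hcirc_eq s_def)
  have s_add: "s (\<mu> + \<nu>) = s \<mu> + s \<nu>" for \<mu> \<nu> by (simp add: s_def)
  have fact_pos: "fact m = real m * fact (m - 1)" if "m \<noteq> 0" for m
    using that by (cases m) auto
  have "w lam * log_coeff hcirc lam = w lam * c lam"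
  proof (rule log_coeff_unique)
    show "w {#} = 0" by (simp add: w_def s_def)
    show "w (\<mu> + \<nu>) = w \<mu> + w \<nu>" for \<mu> \<nu> by (simp add: w_def s_add)
    have "perm_pairs {} {#} = {(id, id)}"
      by (auto simp: perm_pairs_def orbit_sizes_def)
    then show "hcirc {#} = 1" by (simp add: hcirc_eq)
    fix lam
    have split: "s \<mu> + s (lam - \<mu>) = s lam" if "\<mu> \<subseteq># lam" for \<mu>
      using that by (metis s_add subset_mset.add_diff_inverse)
    show "w lam * hcirc lam = (\<Sum>\<mu> | \<mu> \<subseteq># lam. w \<mu> * c \<mu> * hcirc (lam - \<mu>))"
    proof (cases "s lam = 0")
      \<comment> \<open>This includes nonempty multisets of zeros; every submultiset then has weight
        0, so both sides vanish.\<close>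
      case True
      have "w \<mu> = 0" if "\<mu> \<subseteq># lam" for \<mu>
        using split[OF that] True by (simp add: w_def)
      then show ?thesis using True by (simp add: w_def)
    next
      case False
      have rec: "card (perm_pairs {1..s lam} lam) = (\<Sum>\<mu> | \<mu> \<subseteq># lam. if s \<mu> = 0 then 0 else
          ((s lam - 1) choose (s \<mu> - 1)) * card (connected_pairs {1..s \<mu>} \<mu>) *
            card (perm_pairs {1..s (lam - \<mu>)} (lam - \<mu>)))"
        using card_perm_pairs_recursion_nat[of "s lam" lam] False by (simp only: s_def neq0_conv)
      have "w lam * hcirc lam = card (perm_pairs {1..s lam} lam) / fact (s lam - 1)"
        using False by (simp add: w_def hcirc fact_pos[OF False])
      also have "\<dots> = (\<Sum>\<mu> | \<mu> \<subseteq># lam. real (if s \<mu> = 0 then 0 else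
          ((s lam - 1) choose (s \<mu> - 1)) * card (connected_pairs {1..s \<mu>} \<mu>) *
            card (perm_pairs {1..s (lam - \<mu>)} (lam - \<mu>))) / fact (s lam - 1))"
        unfolding rec of_nat_sum sum_divide_distrib ..
      also have "\<dots> = (\<Sum>\<mu> | \<mu> \<subseteq># lam. w \<mu> * c \<mu> * hcirc (lam - \<mu>))"
      proof (intro sum.cong refl)
        fix \<mu> assume "\<mu> \<in> {\<mu>. \<mu> \<subseteq># lam}"
        then have sum: "s \<mu> + s (lam - \<mu>) = s lam" using split by simp
        show "real (if s \<mu> = 0 then 0 else ((s lam - 1) choose (s \<mu> - 1)) *
            card (connected_pairs {1..s \<mu>} \<mu>) * card (perm_pairs {1..s (lam - \<mu>)} (lam - \<mu>)))
            / fact (s lam - 1) = w \<mu> * c \<mu> * hcirc (lam - \<mu>)"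
        proof (cases "s \<mu> = 0")
          case True
          then show ?thesis by (simp add: w_def)
        next
          case k: False
          \<comment> \<open>With n = \<open>s lam\<close> and k = \<open>s \<mu>\<close>, the
            quotient C(n-1, k-1) / (n-1)! equals k / (k! (n-k)!): the factor k is the weight of
            \<mu>, and the two factorials normalise the two counts.\<close>
          have "s lam - 1 - (s \<mu> - 1) = s (lam - \<mu>)" "s \<mu> - 1 \<le> s lam - 1" using sum k by auto
          then have "real ((s lam - 1) choose (s \<mu> - 1)) =
              fact (s lam - 1) / (fact (s \<mu> - 1) * fact (s (lam - \<mu>)))"
            by (simp add: binomial_fact)
          then show ?thesis using k by (simp add: w_def c_def hcirc fact_pos[OF k])
        qed
      qed
      finally show ?thesis .
    qed
  qed
  moreover have "w lam \<noteq> 0" using assms unfolding w_def s_def by (simp only: of_nat_eq_0_iff neq0_conv)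
  ultimately have "log_coeff hcirc lam = c lam" by simp
  then show ?thesis by (simp add: hcoef_eq_log_coeff c_def s_def)
qed

section \<open>Strictly monotone factorisations\<close>

text \<open>The product that occurs in \<open>Htilde\<close>. The last entry of the list acts first,
  so a last factor is removed by composing with it on the right.\<close>

definition transposition_product :: "(nat \<times> nat) list \<Rightarrow> nat \<Rightarrow> nat" where
  "transposition_product ts = foldr (\<lambda>(a, b) f. transpose a b \<circ> f) ts id"

lemma transposition_product_Nil [simp]: "transposition_product [] = id"
  and transposition_product_Cons [simp]:
    "transposition_product ((a, b) # ts) = transpose a b \<circ> transposition_product ts"
  by (simp_all add: transposition_product_def)

lemma transposition_product_snoc [simp]:
  "transposition_product (ts @ [(a, b)]) = transposition_product ts \<circ> transpose a b"
  by (induction ts) (auto simp: o_assoc)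

lemma strictly_monotone_iff_sorted_wrt: "strictly_monotone ts \<longleftrightarrow> sorted_wrt (<) (map snd ts)"
  by (auto simp: strictly_monotone_def sorted_wrt_iff_nth_Suc_transp)

definition monotone_factorisation :: "nat \<Rightarrow> (nat \<Rightarrow> nat) \<Rightarrow> (nat \<times> nat) list \<Rightarrow> bool" where
  "monotone_factorisation n \<pi> ts \<longleftrightarrow> (\<forall>(a, b)\<in>set ts. 1 \<le> a \<and> a < b \<and> b \<le> n)
    \<and> strictly_monotone ts \<and> transposition_product ts = \<pi>"

lemma transposition_product_permutes:
  "\<forall>(a, b)\<in>set ts. 1 \<le> a \<and> a < b \<and> b \<le> n \<Longrightarrow> transposition_product ts permutes {1..n}"
proof (induction ts)
  case Nil
  show ?case unfolding transposition_product_Nil by (rule permutes_id)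
next
  case (Cons t ts)
  obtain a b where "t = (a, b)" by (cases t)
  moreover from this have "transpose a b permutes {1..n}" "transposition_product ts permutes {1..n}"
    using Cons by (auto intro: permutes_swap_id)
  ultimately show ?case by (simp only: transposition_product_Cons permutes_compose)
qed

text \<open>Strict monotonicity permits \<open>Suc n\<close> as larger entry of the last factor
  only. All other factors fix \<open>Suc n\<close>, so a last factor \<open>(a, Suc n)\<close>
  forces \<pi> to send \<open>a\<close> to \<open>Suc n\<close>; without such a factor \<pi> fixes
  \<open>Suc n\<close>.\<close>

lemma monotone_factorisation_Suc:
  assumes "monotone_factorisation (Suc n) \<pi> ts"
  shows "(monotone_factorisation n \<pi> ts \<and> \<pi> (Suc n) = Suc n) \<or>
    (\<exists>us a. ts = us @ [(a, Suc n)] \<and> monotone_factorisation n (\<pi> \<circ> transpose a (Suc n)) us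
      \<and> a \<le> n \<and> \<pi> a = Suc n)"
proof -
  have fix_Suc: "transposition_product us (Suc n) = Suc n"
    if "\<forall>(a, b)\<in>set us. 1 \<le> a \<and> a < b \<and> b \<le> n" for us
    using permutes_not_in[OF transposition_product_permutes[OF that]] by simp
  show ?thesis
  proof (cases ts rule: rev_cases)
    case Nil
    then show ?thesis using assms by (auto simp: monotone_factorisation_def)
  next
    case (snoc us t)
    obtain a b where t: "t = (a, b)" by (cases t)
    have sorted: "sorted_wrt (<) (map snd us)" and less: "\<forall>u\<in>set us. snd u < b"
      and b: "1 \<le> a" "a < b" "b \<le> Suc n" and us: "\<forall>(a, b)\<in>set us. 1 \<le> a \<and> a < b"
      and prod: "transposition_product us \<circ> transpose a b = \<pi>"
      using assms by (auto simp: monotone_factorisation_def snoc t strictly_monotone_iff_sorted_wrt sorted_wrt_append)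
    show ?thesis
    proof (cases "b = Suc n")
      case True
      have us': "\<forall>(a, b)\<in>set us. 1 \<le> a \<and> a < b \<and> b \<le> n"
        using us less True by fastforce
      have "\<pi> \<circ> transpose a (Suc n) = transposition_product us"
        using prod True by (auto simp: o_assoc[symmetric])
      moreover have "\<pi> a = Suc n"
        using prod True fix_Suc[OF us'] by auto
      ultimately show ?thesis
        using us' sorted b True
        by (auto simp: monotone_factorisation_def strictly_monotone_iff_sorted_wrt snoc t)
    next
      case False
      have ts': "\<forall>(a, b)\<in>set ts. 1 \<le> a \<and> a < b \<and> b \<le> n"
        using us less False b by (fastforce simp: snoc t)
      then show ?thesis using assms fix_Suc[OF ts'] by (auto simp: monotone_factorisation_def)
    qed
  qed
qed

section \<open>Cycles after removal of the largest point\<close>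

lemma card_orbits_fixed_point:
  assumes "\<pi> permutes {1..n}"
  shows "card (orbit \<pi> ` {1..Suc n}) = Suc (card (orbit \<pi> ` {1..n}))"
proof -
  have "\<pi> (Suc n) = Suc n" using assms by (simp add: permutes_not_in)
  then have "orbit \<pi> (Suc n) = {Suc n}" by (simp add: orbit_eq_singleton_iff)
  moreover have "{Suc n} \<notin> orbit \<pi> ` {1..n}"
    using permutes_orbit_subset[OF assms] by fastforce
  moreover have "{1..Suc n} = insert (Suc n) {1..n}" by auto
  ultimately show ?thesis by simp
qed

text \<open>Composing with the transposition of \<open>N\<close> and its preimage \<open>a\<close>
  short-circuits the cycle: \<open>a\<close> now goes directly to the successor of \<open>N\<close>,
  \<open>N\<close> becomes a fixed point, and all other arrows are kept.\<close>

lemma orbit_comp_transpose: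
  assumes \<pi>': "\<pi> \<circ> transpose a N permutes A" and A: "finite A" "N \<notin> A" "x \<in> A"
    and \<pi>: "permutation \<pi>" "\<pi> a = N" "\<pi> N \<noteq> N"
  shows "orbit (\<pi> \<circ> transpose a N) x = orbit \<pi> x - {N}"
proof (intro equalityI subsetI)
  let ?\<pi>' = "\<pi> \<circ> transpose a N"
  have perm: "permutation ?\<pi>'" using \<pi>' A by (auto simp: permutation_permutes)
  have sub: "orbit ?\<pi>' x \<subseteq> A" using permutes_orbit_subset[OF \<pi>' A(3)] .
  have val: "?\<pi>' y = (if y = a then \<pi> (\<pi> a) else \<pi> y)" if "y \<noteq> N" for y
    using that \<pi> by (auto simp: transpose_def)
  have inj: "y = a" if "\<pi> y = N" for y
    using that \<pi> by (metis bij_inv_eq_iff permutation_bijective)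
  {
    fix y assume "y \<in> orbit ?\<pi>' x"
    then have "y \<in> orbit \<pi> x \<and> y \<noteq> N"
    proof induct
      case base
      have "?\<pi>' x \<in> A" using \<pi>' A by (metis permutes_in_image)
      moreover have "x \<noteq> N" using A by auto
      moreover have "\<pi> x \<in> orbit \<pi> x" "\<pi> (\<pi> x) \<in> orbit \<pi> x" by (intro orbit.intros)+
      ultimately have "?\<pi>' x \<in> orbit \<pi> x" using val[of x] by (cases "x = a") simp_all
      then show ?case using A(2) \<open>?\<pi>' x \<in> A\<close> by metis
    next
      case (step y)
      then have "?\<pi>' y \<in> A" using subsetD[OF sub orbit.step] by simp
      have "\<pi> y \<in> orbit \<pi> x" using step by (intro orbit.step) simp
      moreover from this have "\<pi> (\<pi> y) \<in> orbit \<pi> x" by (rule orbit.step)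
      ultimately have "?\<pi>' y \<in> orbit \<pi> x" using step val[of y] by (cases "y = a") simp_all
      then show ?case using A(2) \<open>?\<pi>' y \<in> A\<close> by metis
    qed
    then show "y \<in> orbit \<pi> x - {N}" by simp
  next
    \<comment> \<open>A walk along the \<pi>-orbit may pass through \<open>N\<close>, which the new
      orbit omits. The invariant therefore records, at \<open>N\<close>, that its predecessor
      \<open>a\<close> has been reached, from where the new map resumes the walk.\<close>
    have next_in: "(\<pi> y \<noteq> N \<longrightarrow> \<pi> y \<in> orbit ?\<pi>' x) \<and> (\<pi> y = N \<longrightarrow> a \<in> orbit ?\<pi>' x)"
      if "y \<noteq> N \<longrightarrow> y \<in> orbit ?\<pi>' x" "y = N \<longrightarrow> a \<in> orbit ?\<pi>' x" for y
    proof (cases "y = N")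
      case True
      have "a \<noteq> N" using \<pi> by auto
      then have "?\<pi>' a = \<pi> N" using val[of a] \<pi> by simp
      then show ?thesis using True that \<pi> orbit.step[of a ?\<pi>' x] by simp
    next
      case False
      then have y: "y \<in> orbit ?\<pi>' x" using that(1) by blast
      show ?thesis
      proof (cases "y = a")
        case True
        then show ?thesis using y \<pi>(2) by simp
      next
        case ya: False
        then have "?\<pi>' y = \<pi> y" using val[OF False] by (simp only: if_False)
        then have "\<pi> y \<in> orbit ?\<pi>' x" using orbit.step[OF y] by (simp only:)
        moreover have "\<pi> y \<noteq> N" using inj ya by blast
        ultimately show ?thesis by blast
      qed
    qed
    have self: "x \<in> orbit ?\<pi>' x" using permutation_self_in_orbit[OF perm] .
    fix y assume y: "y \<in> orbit \<pi> x - {N}"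
    then have "y \<in> orbit \<pi> x" by simp
    then have "(y \<noteq> N \<longrightarrow> y \<in> orbit ?\<pi>' x) \<and> (y = N \<longrightarrow> a \<in> orbit ?\<pi>' x)"
    proof induct
      case base
      then show ?case using self A by (intro next_in) auto
    next
      case (step y)
      then show ?case using next_in[of y] by blast
    qed
    then show "y \<in> orbit ?\<pi>' x" using y by simp
  }
qed

text \<open>The orbit of \<open>Suc n\<close> is already that of \<open>a\<close>, so starting
  points up to \<open>n\<close> meet all orbits. Deleting \<open>Suc n\<close> merges none of them:
  each keeps such a starting point, and distinct orbits are disjoint.\<close>

lemma card_orbits_comp_transpose:
  assumes \<pi>': "\<pi> \<circ> transpose a (Suc n) permutes {1..n}"
    and \<pi>: "permutation \<pi>" "\<pi> a = Suc n" "\<pi> (Suc n) \<noteq> Suc n" and a: "a \<in> {1..n}"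
  shows "card (orbit (\<pi> \<circ> transpose a (Suc n)) ` {1..n}) = card (orbit \<pi> ` {1..Suc n})"
proof -
  have "orbit \<pi> (Suc n) = orbit \<pi> a"
    using permutation_orbit_step[OF \<pi>(1), of a] \<pi>(2) by simp
  moreover have "{1..Suc n} = insert (Suc n) {1..n}" by auto
  ultimately have 1: "orbit \<pi> ` {1..Suc n} = orbit \<pi> ` {1..n}" using a by auto
  have "orbit (\<pi> \<circ> transpose a (Suc n)) x = orbit \<pi> x - {Suc n}" if "x \<in> {1..n}" for x
    using orbit_comp_transpose[OF \<pi>' _ _ that \<pi>] by simp
  then have 2: "orbit (\<pi> \<circ> transpose a (Suc n)) ` {1..n} = (\<lambda>C. C - {Suc n}) ` orbit \<pi> ` {1..n}"
    unfolding image_image by (intro image_cong) auto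
  have "inj_on (\<lambda>C. C - {Suc n}) (orbit \<pi> ` {1..n})"
  proof (rule inj_onI)
    fix C1 C2 assume C: "C1 \<in> orbit \<pi> ` {1..n}" "C2 \<in> orbit \<pi> ` {1..n}" "C1 - {Suc n} = C2 - {Suc n}"
    then obtain x y where xy: "x \<in> {1..n}" "C1 = orbit \<pi> x" "C2 = orbit \<pi> y" by auto
    have "x \<in> C1 - {Suc n}" using xy permutation_self_in_orbit[OF \<pi>(1)] by auto
    then have "x \<in> C1 \<inter> C2" using C(3) by blast
    then show "C1 = C2" using orbit_eq_or_disjoint[OF \<pi>(1)] xy by blast
  qed
  then show ?thesis unfolding 1 2 by (rule card_image)
qed

text \<open>In a strictly monotone factorisation only the last factor can move \<open>n\<close>, which forces it to be
  \<open>(\<pi>\<inverse> n, n)\<close>; peeling it off splits the point \<open>n\<close> from its cycle and leaves a permutation of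
  \<open>{1..n - 1}\<close>.\<close>
lemma monotone_factorisation_exists_unique:
  assumes "\<pi> permutes {1..n}"
  shows "\<exists>ts. monotone_factorisation n \<pi> ts \<and> (\<forall>us. monotone_factorisation n \<pi> us \<longrightarrow> us = ts)
    \<and> length ts + card (orbit \<pi> ` {1..n}) = n
    \<and> (\<forall>E. (\<forall>y. \<pi> y \<in> E \<longleftrightarrow> y \<in> E) \<longrightarrow> (\<forall>(a, b)\<in>set ts. a \<in> E \<longleftrightarrow> b \<in> E))"
  using assms
proof (induction n arbitrary: \<pi>)
  case 0
  have "us = []" if "monotone_factorisation 0 \<pi> us" for us
    using that by (cases us) (auto simp: monotone_factorisation_def)
  moreover have "monotone_factorisation 0 \<pi> []"
    using 0 by (simp add: monotone_factorisation_def strictly_monotone_def)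
  ultimately show ?case by (intro exI[of _ "[]"]) auto
next
  case (Suc n)
  have inj: "x = y" if "\<pi> x = \<pi> y" for x y using that permutes_inj[OF Suc.prems] by (simp add: inj_eq)
  have fixes_last: "\<rho> permutes {1..n}" if "\<rho> permutes {1..Suc n}" "\<rho> (Suc n) = Suc n" for \<rho>
  proof (rule permutes_superset[OF that(1)])
    fix x assume "x \<in> {1..Suc n} - {1..n}"
    then have "x = Suc n" by auto
    then show "\<rho> x = x" using that(2) by simp
  qed
  show ?case
  proof (cases "\<pi> (Suc n) = Suc n")
    case True
    have \<pi>: "\<pi> permutes {1..n}" by (rule fixes_last[OF Suc.prems True])
    obtain ts where ts: "monotone_factorisation n \<pi> ts" "\<forall>us. monotone_factorisation n \<pi> us \<longrightarrow> us = ts"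
      "length ts + card (orbit \<pi> ` {1..n}) = n"
      "\<forall>E. (\<forall>y. \<pi> y \<in> E \<longleftrightarrow> y \<in> E) \<longrightarrow> (\<forall>(a, b)\<in>set ts. a \<in> E \<longleftrightarrow> b \<in> E)"
      using Suc.IH[OF \<pi>] by blast
    have "monotone_factorisation (Suc n) \<pi> ts"
      using ts(1) by (fastforce simp: monotone_factorisation_def)
    moreover have "us = ts" if "monotone_factorisation (Suc n) \<pi> us" for us
      using monotone_factorisation_Suc[OF that] ts(2) inj[of _ "Suc n"] True by fastforce
    moreover have "length ts + card (orbit \<pi> ` {1..Suc n}) = Suc n"
      using ts(3) by (simp only: card_orbits_fixed_point[OF \<pi>] add_Suc_right)
    ultimately show ?thesis using ts(4) by (intro exI[of _ ts]) blast
  next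
    case False
    define a where "a = inv \<pi> (Suc n)"
    have \<pi>a: "\<pi> a = Suc n" using permutes_inverses[OF Suc.prems] by (simp add: a_def)
    have "a \<in> {1..Suc n}" using \<pi>a permutes_in_image[OF Suc.prems, of a] by simp
    moreover have "a \<noteq> Suc n" using \<pi>a False by auto
    ultimately have a: "a \<in> {1..n}" by auto
    let ?\<pi>' = "\<pi> \<circ> transpose a (Suc n)"
    have \<pi>': "?\<pi>' permutes {1..n}"
      using Suc.prems a \<pi>a by (intro fixes_last permutes_compose permutes_swap_id) auto
    have perm: "permutation \<pi>" using Suc.prems by (auto simp: permutation_permutes)
    obtain us where us: "monotone_factorisation n ?\<pi>' us"
      "\<forall>vs. monotone_factorisation n ?\<pi>' vs \<longrightarrow> vs = us"
      "length us + card (orbit ?\<pi>' ` {1..n}) = n"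
      "\<forall>E. (\<forall>y. ?\<pi>' y \<in> E \<longleftrightarrow> y \<in> E) \<longrightarrow> (\<forall>(a, b)\<in>set us. a \<in> E \<longleftrightarrow> b \<in> E)"
      using Suc.IH[OF \<pi>'] by blast
    let ?ts = "us @ [(a, Suc n)]"
    have "transposition_product us = ?\<pi>'" using us(1) by (simp add: monotone_factorisation_def)
    then have "transposition_product ?ts = \<pi>" by (simp add: o_assoc[symmetric])
    moreover have "\<forall>(a, b)\<in>set ?ts. 1 \<le> a \<and> a < b \<and> b \<le> Suc n" "\<forall>u\<in>set us. snd u < Suc n"
      using us(1) a by (fastforce simp: monotone_factorisation_def)+
    ultimately have "monotone_factorisation (Suc n) \<pi> ?ts"
      using us(1) by (auto simp: monotone_factorisation_def strictly_monotone_iff_sorted_wrt sorted_wrt_append)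
    moreover have "vs = ?ts" if fact: "monotone_factorisation (Suc n) \<pi> vs" for vs
    proof -
      obtain ws c where vs: "vs = ws @ [(c, Suc n)]" "\<pi> c = Suc n"
        "monotone_factorisation n (\<pi> \<circ> transpose c (Suc n)) ws"
        using monotone_factorisation_Suc[OF fact] False by blast
      have "c = a" using inj[of c a] vs(2) \<pi>a by simp
      then show ?thesis using vs us(2) by simp
    qed
    \<comment> \<open>Here the list gains a factor and the number of orbits is unchanged; for a
      fixed point it is the other way round.\<close>
    moreover have "length ?ts + card (orbit \<pi> ` {1..Suc n}) = Suc n"
      using us(3) card_orbits_comp_transpose[OF \<pi>' perm \<pi>a False a] by simp
    moreover have "\<forall>(a, b)\<in>set ?ts. a \<in> E \<longleftrightarrow> b \<in> E" if E: "\<forall>y. \<pi> y \<in> E \<longleftrightarrow> y \<in> E" for E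
    proof -
      \<comment> \<open>As \<pi> carries \<open>a\<close> to \<open>Suc n\<close>, the set
        \<open>E\<close> contains both or neither. The new transposition thus preserves
        \<open>E\<close>, and so does the shortened permutation, to which the induction hypothesis
        applies.\<close>
      have aE: "a \<in> E \<longleftrightarrow> Suc n \<in> E" using E \<pi>a by metis
      then have "\<forall>y. ?\<pi>' y \<in> E \<longleftrightarrow> y \<in> E" using E by (auto simp: transpose_def)
      then show ?thesis using us(4) aE by auto
    qed
    ultimately show ?thesis by (intro exI[of _ ?ts]) blast
  qed
qed

corollary ex1_monotone_factorisation:
  assumes "\<pi> permutes {1..n}"
  shows "\<exists>!ts. monotone_factorisation n \<pi> ts"
proof -
  obtain us where us: "monotone_factorisation n \<pi> us" "\<forall>vs. monotone_factorisation n \<pi> vs \<longrightarrow> vs = us"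
    using monotone_factorisation_exists_unique[OF assms] by blast
  show ?thesis
  proof (rule ex1I)
    show "vs = us" if "monotone_factorisation n \<pi> vs" for vs using us(2) that by blast
  qed (rule us(1))
qed

text \<open>Uniqueness transfers the length of the constructed factorisation to an arbitrary
  one.\<close>

corollary length_monotone_factorisation:
  assumes "\<pi> permutes {1..n}" "monotone_factorisation n \<pi> ts"
  shows "length ts + card (orbit \<pi> ` {1..n}) = n"
proof -
  obtain us where us: "\<forall>vs. monotone_factorisation n \<pi> vs \<longrightarrow> vs = us"
    "length us + card (orbit \<pi> ` {1..n}) = n"
    using monotone_factorisation_exists_unique[OF assms(1)] by blast
  have "ts = us" using us(1) assms(2) by blast
  then show ?thesis using us(2) by simp
qed

corollary monotone_factorisation_preserves:
  assumes "\<pi> permutes {1..n}" "monotone_factorisation n \<pi> ts" "\<And>y. \<pi> y \<in> E \<longleftrightarrow> y \<in> E"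
  shows "\<forall>(a, b)\<in>set ts. a \<in> E \<longleftrightarrow> b \<in> E"
proof -
  obtain us where us: "\<forall>vs. monotone_factorisation n \<pi> vs \<longrightarrow> vs = us"
    "\<forall>E. (\<forall>y. \<pi> y \<in> E \<longleftrightarrow> y \<in> E) \<longrightarrow> (\<forall>(a, b)\<in>set us. a \<in> E \<longleftrightarrow> b \<in> E)"
    using monotone_factorisation_exists_unique[OF assms(1)] by blast
  have "ts = us" using us(1) assms(2) by blast
  then show ?thesis using us(2) assms(3) by blast
qed

section \<open>Transitivity and the two counts\<close>

lemma gen_group_permutes:
  assumes "f \<in> gen_group S" "\<And>s. s \<in> S \<Longrightarrow> s permutes A"
  shows "f permutes A"
  using assms(1) by induct (simp_all only: assms(2) permutes_id permutes_compose permutes_inv)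

text \<open>A set preserved by the generators is preserved by the whole group, so transitivity
  leaves no proper nonempty one. Conversely the group orbit of a point is such a set; closure under
  inverses gives the backward half of its invariance.\<close>

lemma gen_group_transitive_iff:
  assumes S: "\<And>s. s \<in> S \<Longrightarrow> s permutes A"
  shows "(\<forall>x\<in>A. \<forall>y\<in>A. \<exists>f\<in>gen_group S. f x = y) \<longleftrightarrow>
    (\<forall>E\<subseteq>A. (\<forall>s\<in>S. \<forall>y. s y \<in> E \<longleftrightarrow> y \<in> E) \<longrightarrow> E = {} \<or> E = A)"
proof (intro iffI allI impI ballI)
  fix E assume trans: "\<forall>x\<in>A. \<forall>y\<in>A. \<exists>f\<in>gen_group S. f x = y" and E: "E \<subseteq> A"
    and st: "\<forall>s\<in>S. \<forall>y. s y \<in> E \<longleftrightarrow> y \<in> E"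
  have pres: "f y \<in> E \<longleftrightarrow> y \<in> E" if "f \<in> gen_group S" for f y
    using that
  proof (induct arbitrary: y)
    case (gen_inv f)
    then show ?case using inv_mem_iff[of f E] permutes_bij[OF gen_group_permutes[OF _ S]] by blast
  qed (use st in auto)
  show "E = {} \<or> E = A"
  proof (rule ccontr)
    assume "\<not> (E = {} \<or> E = A)"
    then obtain x y where xy: "x \<in> E" "y \<in> A" "y \<notin> E" using E by blast
    then obtain f where "f \<in> gen_group S" "f x = y" using trans E by blast
    then show False using pres xy by blast
  qed
next
  fix x y assume irr: "\<forall>E\<subseteq>A. (\<forall>s\<in>S. \<forall>y. s y \<in> E \<longleftrightarrow> y \<in> E) \<longrightarrow> E = {} \<or> E = A"
    and xy: "x \<in> A" "y \<in> A"
  define E where "E = {f x | f. f \<in> gen_group S}"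
  have "E \<subseteq> A"
    using gen_group_permutes[OF _ S] xy by (auto simp: E_def permutes_in_image)
  moreover have "s z \<in> E \<longleftrightarrow> z \<in> E" if s: "s \<in> S" for s z
  proof
    assume "z \<in> E"
    then obtain f where "f \<in> gen_group S" "z = f x" by (auto simp: E_def)
    then show "s z \<in> E" unfolding E_def
      using gen_comp[OF gen_base[OF s]] by (intro CollectI exI[of _ "s \<circ> f"]) auto
  next
    assume "s z \<in> E"
    then obtain f where f: "f \<in> gen_group S" "s z = f x" by (auto simp: E_def)
    have "z = inv s (f x)" using f(2) permutes_inverses(2)[OF S[OF s]] by metis
    then show "z \<in> E" unfolding E_def
      using gen_comp[OF gen_inv[OF gen_base[OF s]] f(1)] by (intro CollectI exI[of _ "inv s \<circ> f"]) auto
  qed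
  moreover have "id x \<in> E" unfolding E_def using gen_id by blast
  ultimately have "E = A" using irr by blast
  then show "\<exists>f\<in>gen_group S. f x = y" using xy by (auto simp: E_def)
qed

text \<open>Positive parts bound the number of parts by \<open>n\<close>; parts equal to 0 could be
  repeated without limit.\<close>

lemma finite_partitions_of: "finite (partitions_of n)"
proof (rule finite_subset)
  show "partitions_of n \<subseteq> (\<Union>k\<le>n. multisets_of_size {1..n} k)"
  proof
    fix lam assume "lam \<in> partitions_of n"
    then have pos: "\<forall>x\<in>#lam. 0 < x" and sum: "sum_mset lam = n" by (auto simp: partitions_of_def)
    have "size lam \<le> sum_mset lam" using pos by (induction lam) auto
    moreover have "x \<le> sum_mset lam" if "x \<in># lam" for x
      using that by (auto dest!: multi_member_split)
    ultimately show "lam \<in> (\<Union>k\<le>n. multisets_of_size {1..n} k)"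
      using pos sum by (auto simp: multisets_of_size_def Suc_le_eq)
  qed
qed (simp add: finite_multisets_of_size)

lemma orbit_sizes_in_partitions_of:
  assumes "\<pi> permutes {1..n}"
  shows "orbit_sizes {1..n} \<pi> \<in> partitions_of n"
proof -
  have "permutation \<pi>" using assms by (auto simp: permutation_permutes)
  then have "0 < card (orbit \<pi> x)" for x
    using finite_orbit[OF permutation_self_in_orbit] orbit_nonempty by (metis card_gt_0_iff)
  then show ?thesis
    using sum_mset_orbit_sizes[OF _ assms] by (auto simp: partitions_of_def orbit_sizes_def)
qed

text \<open>The common set behind both counts. The genus condition is additive and uses the
  truncated \<open>2 * g - 2\<close>, exactly the list length in \<open>Htilde\<close>.\<close>

definition origamis :: "nat \<Rightarrow> nat \<Rightarrow> ((nat \<Rightarrow> nat) \<times> (nat \<Rightarrow> nat)) set" where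
  "origamis g n = {(\<sigma>, \<rho>). \<sigma> permutes {1..n} \<and> \<rho> permutes {1..n} \<and> irreducible_on \<sigma> \<rho> {1..n}
    \<and> card (orbit (commutator \<sigma> \<rho>) ` {1..n}) + (2 * g - 2) = n}"

lemma H_eq_card_origamis:
  assumes "1 \<le> g" "1 \<le> n"
  shows "H g n = card (origamis g n) / fact n"
proof -
  let ?P = "{lam \<in> partitions_of n. int (size lam) = int n + 2 - 2 * int g}"
  have "H g n = (\<Sum>lam\<in>?P. card (connected_pairs {1..n} lam) / fact n)"
    unfolding H_def using assms hcoef_eq_connected
    by (intro sum.cong) (auto simp: partitions_of_def)
  also have "\<dots> = real (\<Sum>lam\<in>?P. card (connected_pairs {1..n} lam)) / fact n"
    by (simp add: sum_divide_distrib)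
  also have "(\<Sum>lam\<in>?P. card (connected_pairs {1..n} lam)) = card (\<Union>lam\<in>?P. connected_pairs {1..n} lam)"
  proof (rule card_UN_disjoint[symmetric])
    show "\<forall>lam\<in>?P. \<forall>\<mu>\<in>?P. lam \<noteq> \<mu> \<longrightarrow> connected_pairs {1..n} lam \<inter> connected_pairs {1..n} \<mu> = {}"
      by (auto simp: connected_pairs_def perm_pairs_def)
  qed (simp_all add: finite_partitions_of finite_connected_pairs)
  also have "(\<Union>lam\<in>?P. connected_pairs {1..n} lam) = origamis g n"
  proof -
    have size: "size (orbit_sizes A \<pi>) = card (orbit \<pi> ` A)" for A \<pi>
      by (simp add: orbit_sizes_def)
    \<comment> \<open>For positive \<open>g\<close> the truncated difference agrees with the integer
      one.\<close>
    have "int k = int n + 2 - 2 * int g \<longleftrightarrow> k + (2 * g - 2) = n" for k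
      using assms(1) by linarith
    then have "orbit_sizes {1..n} (commutator \<sigma> \<rho>) \<in> ?P \<longleftrightarrow>
        card (orbit (commutator \<sigma> \<rho>) ` {1..n}) + (2 * g - 2) = n"
      if "\<sigma> permutes {1..n}" "\<rho> permutes {1..n}" for \<sigma> \<rho>
      using orbit_sizes_in_partitions_of[OF commutator_permutes[OF that]] size by simp
    then show ?thesis
      unfolding origamis_def connected_pairs_def perm_pairs_def by blast
  qed
  finally show ?thesis .
qed

lemma transitive_iff_irreducible_on:
  assumes p: "\<sigma> permutes {1..n}" "\<rho> permutes {1..n}"
    and ts: "monotone_factorisation n (inv (commutator \<sigma> \<rho>)) ts"
  shows "(\<forall>x\<in>{1..n}. \<forall>y\<in>{1..n}. \<exists>f\<in>gen_group ({\<sigma>, \<rho>} \<union> (\<lambda>(a, b). transpose a b) ` set ts). f x = y)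
    \<longleftrightarrow> irreducible_on \<sigma> \<rho> {1..n}"
proof -
  let ?S = "{\<sigma>, \<rho>} \<union> (\<lambda>(a, b). transpose a b) ` set ts"
  have S: "s permutes {1..n}" if "s \<in> ?S" for s
    using that p ts by (auto simp: monotone_factorisation_def intro!: permutes_swap_id)
  note c = commutator_permutes[OF p]
  have stable: "(\<forall>s\<in>?S. \<forall>y. s y \<in> E \<longleftrightarrow> y \<in> E) \<longleftrightarrow> stable_under \<sigma> \<rho> E" for E
  proof
    assume st: "stable_under \<sigma> \<rho> E"
    have "\<forall>y. inv (commutator \<sigma> \<rho>) y \<in> E \<longleftrightarrow> y \<in> E"
      using inv_mem_iff[OF permutes_bij[OF c]] commutator_mem_iff[OF p[THEN permutes_bij] st] by blast
    then have "\<forall>(a, b)\<in>set ts. a \<in> E \<longleftrightarrow> b \<in> E"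
      using monotone_factorisation_preserves[OF permutes_inv[OF c] ts] by blast
    then have "transpose a b y \<in> E \<longleftrightarrow> y \<in> E" if "(a, b) \<in> set ts" for a b y
      using that by (auto simp: transpose_def)
    then show "\<forall>s\<in>?S. \<forall>y. s y \<in> E \<longleftrightarrow> y \<in> E"
      using st by (auto simp: stable_under_def)
  qed (auto simp: stable_under_def)
  have "(\<forall>x\<in>{1..n}. \<forall>y\<in>{1..n}. \<exists>f\<in>gen_group ?S. f x = y) \<longleftrightarrow>
      (\<forall>E\<subseteq>{1..n}. (\<forall>s\<in>?S. \<forall>y. s y \<in> E \<longleftrightarrow> y \<in> E) \<longrightarrow> E = {} \<or> E = {1..n})"
    by (rule gen_group_transitive_iff) (rule S)
  then show ?thesis unfolding stable irreducible_on_def .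
qed

text \<open>The product equation says that \<open>ts\<close> factorises the inverse of the
  commutator, which has the same cycles as the commutator. Hence the pair determines
  \<open>ts\<close>, the prescribed length fixes the number of cycles, and forgetting
  \<open>ts\<close> is a bijection.\<close>

lemma Htilde_eq_card_origamis: "Htilde g n = card (origamis g n) / fact n"
proof -
  define X where "X = {(\<sigma>, \<rho>, ts). \<sigma> permutes {1..n} \<and> \<rho> permutes {1..n} \<and> irreducible_on \<sigma> \<rho> {1..n}
    \<and> monotone_factorisation n (inv (commutator \<sigma> \<rho>)) ts \<and> length ts = 2 * g - 2}"
  have comp: "commutator \<sigma> \<rho> \<circ> f = id \<longleftrightarrow> f = inv (commutator \<sigma> \<rho>)"
    if "\<sigma> permutes {1..n}" "\<rho> permutes {1..n}" for \<sigma> \<rho> f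
    using permutes_inv_o[OF commutator_permutes[OF that]] by (metis comp_id id_comp o_assoc)
  have "{(\<sigma>, \<rho>, ts). \<sigma> permutes {1..n} \<and> \<rho> permutes {1..n}
     \<and> length ts = 2 * g - 2
     \<and> (\<forall>(a, b)\<in>set ts. 1 \<le> a \<and> a < b \<and> b \<le> n)
     \<and> strictly_monotone ts
     \<and> commutator \<sigma> \<rho> \<circ> foldr (\<lambda>(a, b) f. transpose a b \<circ> f) ts id = id
     \<and> (\<forall>x\<in>{1..n}. \<forall>y\<in>{1..n}. \<exists>f\<in>gen_group ({\<sigma>, \<rho>} \<union> (\<lambda>(a, b). transpose a b) ` set ts). f x = y)}
     = X" (is "?Y = X")
  proof (intro set_eqI)
    fix z :: "(nat \<Rightarrow> nat) \<times> (nat \<Rightarrow> nat) \<times> (nat \<times> nat) list"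
    obtain \<sigma> \<rho> ts where z: "z = (\<sigma>, \<rho>, ts)" by (cases z)
    show "z \<in> ?Y \<longleftrightarrow> z \<in> X"
    proof (cases "\<sigma> permutes {1..n} \<and> \<rho> permutes {1..n}")
      case True
      then have p: "\<sigma> permutes {1..n}" "\<rho> permutes {1..n}" by auto
      show ?thesis
        unfolding z X_def mem_Collect_eq prod.case comp[OF p]
        using transitive_iff_irreducible_on[OF p, of ts] p
        unfolding monotone_factorisation_def transposition_product_def by blast
    qed (auto simp: z X_def)
  qed
  then have "Htilde g n = card X / fact n" unfolding Htilde_def by simp
  also have "card X = card (origamis g n)"
  proof (rule bij_betw_same_card)
    have len: "length ts + card (orbit (commutator \<sigma> \<rho>) ` {1..n}) = n"
      if "\<sigma> permutes {1..n}" "\<rho> permutes {1..n}" "monotone_factorisation n (inv (commutator \<sigma> \<rho>)) ts" for \<sigma> \<rho> ts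
    proof -
      note c = commutator_permutes[OF that(1,2)]
      have "permutation (commutator \<sigma> \<rho>)" using c by (auto simp: permutation_permutes)
      then have orbit: "orbit (inv (commutator \<sigma> \<rho>)) = orbit (commutator \<sigma> \<rho>)"
        by (intro ext orbit_inv_eq)
      show ?thesis
        using length_monotone_factorisation[OF permutes_inv[OF c] that(3)] unfolding orbit .
    qed
    have ex1: "\<exists>!ts. monotone_factorisation n (inv (commutator \<sigma> \<rho>)) ts"
      if "\<sigma> permutes {1..n}" "\<rho> permutes {1..n}" for \<sigma> \<rho>
      by (intro ex1_monotone_factorisation permutes_inv commutator_permutes that)
    let ?f = "\<lambda>(\<sigma>, \<rho>, ts :: (nat \<times> nat) list). (\<sigma> :: nat \<Rightarrow> nat, \<rho> :: nat \<Rightarrow> nat)"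
    show "bij_betw ?f X (origamis g n)"
      unfolding bij_betw_def
    proof
      show "inj_on ?f X"
      proof (rule inj_onI)
        fix u v assume uv: "u \<in> X" "v \<in> X" "?f u = ?f v"
        obtain \<sigma> \<rho> ts where u: "u = (\<sigma>, \<rho>, ts)" by (cases u)
        obtain us where v: "v = (\<sigma>, \<rho>, us)" using uv(3) by (cases v) (auto simp: u)
        have "ts = us" using uv(1,2) ex1[of \<sigma> \<rho>] unfolding u v X_def by blast
        then show "u = v" by (simp add: u v)
      qed
      show "?f ` X = origamis g n"
      proof (intro equalityI subsetI)
        fix z assume "z \<in> ?f ` X"
        then obtain \<sigma> \<rho> ts where z: "z = (\<sigma>, \<rho>)" and X: "(\<sigma>, \<rho>, ts) \<in> X" by auto
        then have p: "\<sigma> permutes {1..n}" "\<rho> permutes {1..n}"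
          and ts: "monotone_factorisation n (inv (commutator \<sigma> \<rho>)) ts" "length ts = 2 * g - 2"
          by (simp_all add: X_def)
        have "card (orbit (commutator \<sigma> \<rho>) ` {1..n}) + (2 * g - 2) = n"
          using len[OF p ts(1)] ts(2) by (simp only: add.commute)
        then show "z \<in> origamis g n" using X by (simp add: z X_def origamis_def)
      next
        fix z assume "z \<in> origamis g n"
        then obtain \<sigma> \<rho> where z: "z = (\<sigma>, \<rho>)" and p: "\<sigma> permutes {1..n}" "\<rho> permutes {1..n}"
          and irr: "irreducible_on \<sigma> \<rho> {1..n}"
          and c: "card (orbit (commutator \<sigma> \<rho>) ` {1..n}) + (2 * g - 2) = n"
          by (auto simp: origamis_def)
        obtain ts where ts: "monotone_factorisation n (inv (commutator \<sigma> \<rho>)) ts" using ex1[OF p] by blast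
        then have "length ts = 2 * g - 2" using len[OF p ts] c by simp
        then have "(\<sigma>, \<rho>, ts) \<in> X" using p irr ts by (simp add: X_def)
        then show "z \<in> ?f ` X" unfolding z by force
      qed
    qed
  qed
  finally show ?thesis .
qed

theorem mainTheorem7:
  fixes g n :: nat
  assumes "1 \<le> g" and "1 \<le> n"
  shows "Htilde g n = H g n"
  using assms by (simp add: Htilde_eq_card_origamis H_eq_card_origamis)

end
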